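(* Let $X$ be a complex Banach space, let $1\le p<\infty$ and $1/p+1/q=1$, and let $(R(t))_{t>0}\subseteq L(X)$ be a strongly continuous operator family satisfying $$M:=\sum_{k=0}^{\infty}\|R(\cdot)\|_{L^{q}[k,k+1]}<\infty.$$ If $g:\mathbb{R}\to X$ is $S^{p}$-almost anti-periodic, then the function $G$ given by $$G(t):=\int_{-\infty}^{t}R(t-s)g(s)\,ds,\quad t\in\mathbb{R},$$ is well-defined and almost anti-periodic.
   Context: $L(X)$ denotes the space of bounded linear operators on the complex Banach space $X$. For $p=1$ one takes $q=\infty$. $\|R(\cdot)\|_{L^q[k,k+1]}$ is the $L^q$-norm over $[k,k+1]$ of the scalar function $t\mapsto\|R(t)\|_{L(X)}$. Let $Y$ be a Banach space. A subset $S\subseteq \mathbb{R}$ is relatively dense in $\mathbb{R}$ if there exists $l>0$ such that every subinterval of $\mathbb{R}$ of length $l$ meets $S$. A continuous function $f:\mathbb{R}\to Y$ is almost anti-periodic if for each $\epsilon>0$ the set of all $\epsilon$-antiperiods of $f$ is relatively dense in $\mathbb{R}$, where $\tau\in\mathbb{R}\setminus\{0\}$ is an $\epsilon$-antiperiod for $f$ if $\|f(t+\tau)+f(t)\|\le\epsilon$ for all $t\in\mathbb{R}$. A function $g\in L^p_{loc}(\mathbb{R}:X)$ is Stepanov $p$-almost anti-periodic ($S^p$-almost anti-periodic) if the function $\hat g:\mathbb{R}\to L^p([0,1]:X)$, $\hat g(t)(s):=g(t+s)$ for $t\in\mathbb{R}$, $s\in[0,1]$, is almost anti-periodic. *)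

theory Defs
  imports
    "HOL-Analysis.Analysis"
    "HOL-Probability.Essential_Supremum"
    "HOL-Library.Function_Algebras"
begin

subsection \<open>Complex Banach spaces\<close>

class complex_banach = banach +
  fixes scaleC :: "complex \<Rightarrow> 'a \<Rightarrow> 'a"
  assumes scaleC_add_right: "scaleC c (x + y) = scaleC c x + scaleC c y"
    and scaleC_add_left: "scaleC (c + d) x = scaleC c x + scaleC d x"
    and scaleC_scaleC: "scaleC c (scaleC d x) = scaleC (c * d) x"
    and scaleC_of_real: "scaleC (complex_of_real r) x = scaleR r x"
    and norm_scaleC: "norm (scaleC c x) = cmod c * norm x"

instantiation complex :: complex_banach
begin

definition scaleC_complex :: "complex \<Rightarrow> complex \<Rightarrow> complex"
  where "scaleC_complex c x = c * x"

instance
  by standard (simp_all add: scaleC_complex_def algebra_simps norm_mult scaleR_conv_of_real)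

end

text \<open>The elements of $L(X)$ are the complex-linear members of the type of bounded real-linear
  operators; for these the norm is the usual operator norm.\<close>

definition complex_linear :: "('a::complex_banach \<Rightarrow>\<^sub>L 'a) \<Rightarrow> bool"
  where "complex_linear A \<longleftrightarrow> (\<forall>c x. blinfun_apply A (scaleC c x) = scaleC c (blinfun_apply A x))"

text \<open>The values $R(t)$ for $t \le 0$ are unconstrained.\<close>

definition strongly_continuous_family :: "(real \<Rightarrow> 'a::complex_banach \<Rightarrow>\<^sub>L 'a) \<Rightarrow> bool"
  where "strongly_continuous_family R \<longleftrightarrow>
    (\<forall>t>0. complex_linear (R t)) \<and> (\<forall>x. continuous_on {0<..} (\<lambda>t. blinfun_apply (R t) x))"


subsection \<open>Integration of functions with values in an arbitrary Banach space\<close>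

text \<open>The library's Bochner integral is confined to second countable (separable) target spaces.
  The definitions below repeat it without this restriction.\<close>

definition has_Bochner_integral ::
    "'a measure \<Rightarrow> ('a \<Rightarrow> 'b::real_normed_vector) \<Rightarrow> 'b \<Rightarrow> bool"
  where "has_Bochner_integral M f x \<longleftrightarrow>
    f \<in> borel_measurable M \<and>
    (\<exists>s. (\<forall>i::nat. Bochner_Integration.simple_bochner_integrable M (s i)) \<and>
         (\<lambda>i. \<integral>\<^sup>+ y. ennreal (norm (f y - s i y)) \<partial>M) \<longlonglongrightarrow> 0 \<and>
         (\<lambda>i. Bochner_Integration.simple_bochner_integral M (s i)) \<longlonglongrightarrow> x)"

definition Bochner_integrable :: "'a measure \<Rightarrow> ('a \<Rightarrow> 'b::real_normed_vector) \<Rightarrow> bool"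
  where "Bochner_integrable M f \<longleftrightarrow> (\<exists>x. has_Bochner_integral M f x)"

definition Bochner_integral :: "'a measure \<Rightarrow> ('a \<Rightarrow> 'b::real_normed_vector) \<Rightarrow> 'b"
  where "Bochner_integral M f = (THE x. has_Bochner_integral M f x)"

lemma has_Bochner_integral_eq_library:
  fixes f :: "'a \<Rightarrow> 'b::{real_normed_vector, second_countable_topology}"
  shows "has_Bochner_integral M f x \<longleftrightarrow> has_bochner_integral M f x"
  unfolding has_Bochner_integral_def has_bochner_integral.simps by auto

text \<open>In a non-separable space Borel measurability does not suffice for membership in $L^p$.\<close>

definition strongly_measurable :: "'a measure \<Rightarrow> ('a \<Rightarrow> 'b::real_normed_vector) \<Rightarrow> bool"
  where "strongly_measurable M f \<longleftrightarrow>
    (\<exists>s. (\<forall>i::nat. simple_function M (s i)) \<and> (AE x in M. (\<lambda>i. s i x) \<longlonglongrightarrow> f x))"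

text \<open>The $L^p$-(semi)norm, $p \in [1,\infty]$, of a (strongly) measurable function.\<close>

definition Lp_norm :: "ennreal \<Rightarrow> 'a measure \<Rightarrow> ('a \<Rightarrow> 'b::real_normed_vector) \<Rightarrow> ennreal"
  where "Lp_norm p M f =
    (if p = \<infinity> then esssup M (\<lambda>x. ennreal (norm (f x)))
     else let I = \<integral>\<^sup>+ x. ennreal (norm (f x) powr enn2real p) \<partial>M
          in if I = \<infinity> then \<infinity> else ennreal (enn2real I powr (1 / enn2real p)))"

definition Lp_loc :: "real \<Rightarrow> (real \<Rightarrow> 'a::real_normed_vector) \<Rightarrow> bool"
  where "Lp_loc p g \<longleftrightarrow>
    strongly_measurable lebesgue g \<and>
    (\<forall>K. compact K \<longrightarrow> Lp_norm (ennreal p) (lebesgue_on K) g < \<infinity>)"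


subsection \<open>Almost anti-periodicity\<close>

text \<open>Every interval of length $l$, of whatever kind, contains the open one with the same
  end points.\<close>

definition relatively_dense :: "real set \<Rightarrow> bool"
  where "relatively_dense S \<longleftrightarrow> (\<exists>l>0. \<forall>a. {a<..<a + l} \<inter> S \<noteq> {})"

definition antiperiods :: "(real \<Rightarrow> 'y::real_normed_vector) \<Rightarrow> real \<Rightarrow> real set"
  where "antiperiods f \<epsilon> = {\<tau>. \<tau> \<noteq> 0 \<and> (\<forall>t. norm (f (t + \<tau>) + f t) \<le> \<epsilon>)}"

definition almost_anti_periodic :: "(real \<Rightarrow> 'y::real_normed_vector) \<Rightarrow> bool"
  where "almost_anti_periodic f \<longleftrightarrow>
    continuous_on UNIV f \<and> (\<forall>\<epsilon>>0. relatively_dense (antiperiods f \<epsilon>))"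

text \<open>$L^p([0,1] : X)$ is not a type, as it depends on the number $p$. The same notion is
  therefore also stated for a space whose norm is an explicit argument \<open>N\<close>, its elements being
  given by representatives.\<close>

definition antiperiods_wrt ::
    "('y::ab_group_add \<Rightarrow> ennreal) \<Rightarrow> (real \<Rightarrow> 'y) \<Rightarrow> real \<Rightarrow> real set"
  where "antiperiods_wrt N f \<epsilon> = {\<tau>. \<tau> \<noteq> 0 \<and> (\<forall>t. N (f (t + \<tau>) + f t) \<le> ennreal \<epsilon>)}"

definition almost_anti_periodic_wrt ::
    "('y::ab_group_add \<Rightarrow> ennreal) \<Rightarrow> (real \<Rightarrow> 'y) \<Rightarrow> bool"
  where "almost_anti_periodic_wrt N f \<longleftrightarrow>
    (\<forall>t. ((\<lambda>s. N (f s - f t)) \<longlongrightarrow> 0) (at t)) \<and>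
    (\<forall>\<epsilon>>0. relatively_dense (antiperiods_wrt N f \<epsilon>))"

lemma almost_anti_periodic_wrt_norm:
  "almost_anti_periodic_wrt (\<lambda>y. ennreal (norm y)) f \<longleftrightarrow> almost_anti_periodic f"
proof -
  have "((\<lambda>s. ennreal (norm (f s - f t))) \<longlongrightarrow> 0) (at t) \<longleftrightarrow> isCont f t" for t
  proof -
    have "((\<lambda>s. ennreal (norm (f s - f t))) \<longlongrightarrow> ennreal 0) (at t)
        \<longleftrightarrow> ((\<lambda>s. norm (f s - f t)) \<longlongrightarrow> 0) (at t)"
      by (intro tendsto_ennreal_iff) auto
    then show ?thesis
      by (simp add: isCont_def tendsto_norm_zero_iff LIM_zero_iff)
  qed
  moreover have "antiperiods_wrt (\<lambda>y. ennreal (norm y)) f \<epsilon> = antiperiods f \<epsilon>" if "\<epsilon> > 0" for \<epsilon>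
    using that by (simp add: antiperiods_wrt_def antiperiods_def)
  ultimately show ?thesis
    by (simp add: almost_anti_periodic_wrt_def almost_anti_periodic_def
        continuous_on_eq_continuous_at)
qed

definition Stepanov_lift :: "(real \<Rightarrow> 'a) \<Rightarrow> real \<Rightarrow> real \<Rightarrow> 'a"
  where "Stepanov_lift g t = (\<lambda>s. g (t + s))"

text \<open>Addition and subtraction of functions are pointwise. Local $p$-integrability puts every
  value of the lift into $L^p([0,1] : X)$.\<close>

definition Stepanov_almost_anti_periodic ::
    "real \<Rightarrow> (real \<Rightarrow> 'a::real_normed_vector) \<Rightarrow> bool"
  where "Stepanov_almost_anti_periodic p g \<longleftrightarrow>
    Lp_loc p g \<and>
    almost_anti_periodic_wrt (Lp_norm (ennreal p) (lebesgue_on {0..1})) (Stepanov_lift g)"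

end

theory Submission
  imports Defs
begin

text \<open>After the substitution $s = t - r$, $G(t) = \int_0^\infty R(r)\, g(t - r)\, dr$. Cutting $(0, \infty)$
  into unit intervals and applying Hoelder's inequality on each gives, for every strongly
  measurable $h$,
  $$\int_0^\infty \|R(r)\, h(t - r)\|\, dr \le
    \sum_k \|R\|_{L^q[k,k+1]} \, \|\hat h(t - k - 1)\|_{L^p[0,1]}.$$
  With $h = g$ this yields the existence of $G$, since $\hat g$ is bounded: an antiperiod moves any
  point into a fixed compact interval. With $h = g(\cdot + \tau) + g$ it shows that
  $\epsilon/(M+1)$-antiperiods of $\hat g$ are $\epsilon$-antiperiods of $G$, and with
  $h = g(\cdot + c) - g$, $c \to 0$, continuity of $G$ follows from continuity of $\hat g$ by dominated
  convergence of the series.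

  Strong measurability of $r \mapsto R(r)\, h(t - r)$ comes from the uniform boundedness principle: if
  $r_i \to r$ and $s_i \to y$ then $R(r_i)\, s_i \to R(r)\, y$.\<close>

subsection \<open>The Bochner integral in non-separable spaces\<close>

text \<open>Without separability a difference of Borel functions need not be Borel. Here the
  subtrahend has finitely many values, so a preimage is a finite union of preimages under translates
  of \<open>f\<close>.\<close>

lemma borel_measurable_diff_simple_function:
  fixes f :: "'a \<Rightarrow> 'b::real_normed_vector"
  assumes f: "f \<in> borel_measurable M" and s: "simple_function M s"
  shows "(\<lambda>x. f x - s x) \<in> borel_measurable M"
proof (rule borel_measurableI)
  fix S :: "'b set" assume "open S"
  have fy: "(\<lambda>x. f x - y) -` S \<inter> space M \<in> sets M" for y
  proof -
    have "(\<lambda>z. z - y) \<in> borel_measurable borel"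
      by (intro borel_measurable_continuous_onI continuous_intros)
    from measurable_compose[OF f this] show ?thesis
      using \<open>open S\<close> by (auto intro: measurable_sets)
  qed
  have "(\<lambda>x. f x - s x) -` S \<inter> space M =
      (\<Union>y\<in>s ` space M. (s -` {y} \<inter> space M) \<inter> ((\<lambda>x. f x - y) -` S \<inter> space M))"
    by auto
  also have "\<dots> \<in> sets M"
    by (intro sets.finite_UN sets.Int simple_functionD[OF s] fy)
  finally show "(\<lambda>x. f x - s x) -` S \<inter> space M \<in> sets M" .
qed

lemma simple_bochner_integral_norm_le:
  assumes "Bochner_Integration.simple_bochner_integrable M s"
  shows "ennreal (norm (Bochner_Integration.simple_bochner_integral M s)) \<le> (\<integral>\<^sup>+x. norm (s x) \<partial>M)"
proof -
  have "Bochner_Integration.simple_bochner_integrable M (\<lambda>x. norm (s x))"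
    using simple_bochner_integrable_compose2[of "\<lambda>x y. norm x" M s s] assms by auto
  from simple_bochner_integral_eq_nn_integral[OF this] simple_bochner_integral_norm_bound[OF assms]
  show ?thesis
    by (metis ennreal_leI norm_ge_zero)
qed

text \<open>The triangle inequality through \<open>f\<close>. This one estimate serves three
  purposes below: uniqueness of the integral, the norm bound, and the Cauchy property of
  approximating integrals.\<close>

lemma simple_bochner_integral_diff_le:
  fixes f :: "'a \<Rightarrow> 'b::real_normed_vector"
  assumes f: "f \<in> borel_measurable M"
    and s: "Bochner_Integration.simple_bochner_integrable M s" and t: "Bochner_Integration.simple_bochner_integrable M t"
  shows "ennreal (norm (Bochner_Integration.simple_bochner_integral M s - Bochner_Integration.simple_bochner_integral M t)) \<le>
    (\<integral>\<^sup>+ x. norm (f x - s x) \<partial>M) + (\<integral>\<^sup>+ x. norm (f x - t x) \<partial>M)"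
proof -
  have st: "simple_function M s" "simple_function M t"
    using s t by (auto elim: simple_bochner_integrable.cases)
  note [measurable] = borel_measurable_diff_simple_function[OF f st(1)]
    borel_measurable_diff_simple_function[OF f st(2)]
  have "ennreal (norm (Bochner_Integration.simple_bochner_integral M s - Bochner_Integration.simple_bochner_integral M t)) =
      ennreal (norm (Bochner_Integration.simple_bochner_integral M (\<lambda>x. s x - t x)))"
    using s t by (subst simple_bochner_integral_diff) auto
  also have "\<dots> \<le> (\<integral>\<^sup>+x. norm (s x - t x) \<partial>M)"
    using simple_bochner_integrable_compose2[of "(-)" M s t] s t
    by (intro simple_bochner_integral_norm_le) auto
  also have "\<dots> \<le> (\<integral>\<^sup>+x. ennreal (norm (f x - s x)) + ennreal (norm (f x - t x)) \<partial>M)"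
  proof (intro nn_integral_mono)
    fix x
    have "norm (s x - t x) \<le> norm (f x - s x) + norm (f x - t x)"
      by (metis dual_order.refl norm_diff_triangle_le norm_minus_commute)
    then show "ennreal (norm (s x - t x)) \<le> ennreal (norm (f x - s x)) + ennreal (norm (f x - t x))"
      by (simp flip: ennreal_plus)
  qed
  also have "\<dots> = (\<integral>\<^sup>+ x. norm (f x - s x) \<partial>M) + (\<integral>\<^sup>+ x. norm (f x - t x) \<partial>M)"
    by (rule nn_integral_add) auto
  finally show ?thesis .
qed

text \<open>Two approximating sequences are both close to \<open>f\<close> in L1, hence their
  integrals are close to each other. This justifies the definite description in
  \<open>Bochner_integral\<close>.\<close>

lemma has_Bochner_integral_unique:
  assumes "has_Bochner_integral M f x" "has_Bochner_integral M f y"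
  shows "x = y"
proof -
  from assms obtain s t where f: "f \<in> borel_measurable M"
    and s: "\<And>i. Bochner_Integration.simple_bochner_integrable M (s i)" "(\<lambda>i. \<integral>\<^sup>+ y. norm (f y - s i y) \<partial>M) \<longlonglongrightarrow> 0"
      "(\<lambda>i. Bochner_Integration.simple_bochner_integral M (s i)) \<longlonglongrightarrow> x"
    and t: "\<And>i. Bochner_Integration.simple_bochner_integrable M (t i)" "(\<lambda>i. \<integral>\<^sup>+ y. norm (f y - t i y) \<partial>M) \<longlonglongrightarrow> 0"
      "(\<lambda>i. Bochner_Integration.simple_bochner_integral M (t i)) \<longlonglongrightarrow> y"
    unfolding has_Bochner_integral_def by blast
  have "(\<lambda>i. ennreal (norm (Bochner_Integration.simple_bochner_integral M (s i) - Bochner_Integration.simple_bochner_integral M (t i))))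
      \<longlonglongrightarrow> ennreal (norm (x - y))"
    by (intro tendsto_intros s t)
  moreover have "(\<lambda>i. (\<integral>\<^sup>+ y. norm (f y - s i y) \<partial>M) + (\<integral>\<^sup>+ y. norm (f y - t i y) \<partial>M)) \<longlonglongrightarrow> 0 + 0"
    by (intro tendsto_add s t)
  ultimately have "ennreal (norm (x - y)) \<le> 0 + 0"
    by (rule LIMSEQ_le) (auto intro!: exI[of _ 0] simple_bochner_integral_diff_le f s t)
  then show ?thesis by simp
qed

lemma has_Bochner_integral_integral_eq:
  "has_Bochner_integral M f x \<Longrightarrow> Bochner_integral M f = x"
  unfolding Bochner_integral_def by (blast intro: has_Bochner_integral_unique)

lemma has_Bochner_integral_norm_le:
  assumes "has_Bochner_integral M f x"
  shows "ennreal (norm x) \<le> (\<integral>\<^sup>+y. norm (f y) \<partial>M)"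
proof -
  from assms obtain s where f: "f \<in> borel_measurable M"
    and s: "\<And>i. Bochner_Integration.simple_bochner_integrable M (s i)" "(\<lambda>i. \<integral>\<^sup>+ y. norm (f y - s i y) \<partial>M) \<longlonglongrightarrow> 0"
      "(\<lambda>i. Bochner_Integration.simple_bochner_integral M (s i)) \<longlonglongrightarrow> x"
    unfolding has_Bochner_integral_def by blast
  \<comment> \<open>Taking the second simple function to be 0 turns the difference estimate into a
    bound by the L1-distance to \<open>f\<close> plus the L1-norm of \<open>f\<close>.\<close>
  have "Bochner_Integration.simple_bochner_integrable M (\<lambda>_. 0::'b)"
    by (auto intro: simple_bochner_integrable.intros)
  have "Bochner_Integration.simple_bochner_integral M (\<lambda>_. 0::'b) = 0"
    by (auto simp: Bochner_Integration.simple_bochner_integral_def intro: sum.neutral)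
  with simple_bochner_integral_diff_le[OF f s(1) \<open>Bochner_Integration.simple_bochner_integrable M (\<lambda>_. 0)\<close>]
  have le: "ennreal (norm (Bochner_Integration.simple_bochner_integral M (s i))) \<le>
      (\<integral>\<^sup>+ y. norm (f y - s i y) \<partial>M) + (\<integral>\<^sup>+ y. norm (f y) \<partial>M)" for i
    by simp
  have "(\<lambda>i. ennreal (norm (Bochner_Integration.simple_bochner_integral M (s i)))) \<longlonglongrightarrow> ennreal (norm x)"
    by (intro tendsto_intros s)
  moreover have "(\<lambda>i. (\<integral>\<^sup>+ y. norm (f y - s i y) \<partial>M) + (\<integral>\<^sup>+ y. norm (f y) \<partial>M)) \<longlonglongrightarrow>
      0 + (\<integral>\<^sup>+ y. norm (f y) \<partial>M)"
    by (intro tendsto_add s tendsto_const)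
  ultimately have "ennreal (norm x) \<le> 0 + (\<integral>\<^sup>+y. norm (f y) \<partial>M)"
    by (rule LIMSEQ_le) (use le in blast)
  then show ?thesis by simp
qed

text \<open>The approximating sequences are added termwise. Measurability of the sum is a hypothesis
  because it does not follow from that of the summands in a non-separable space; strong
  measurability supplies it later.\<close>

lemma has_Bochner_integral_add:
  assumes f: "has_Bochner_integral M f x" and g: "has_Bochner_integral M g y"
    and fg: "(\<lambda>z. f z + g z) \<in> borel_measurable M"
  shows "has_Bochner_integral M (\<lambda>z. f z + g z) (x + y)"
proof -
  from f g obtain s t where m: "f \<in> borel_measurable M" "g \<in> borel_measurable M"
    and s: "\<And>i. Bochner_Integration.simple_bochner_integrable M (s i)" "(\<lambda>i. \<integral>\<^sup>+ y. norm (f y - s i y) \<partial>M) \<longlonglongrightarrow> 0"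
      "(\<lambda>i. Bochner_Integration.simple_bochner_integral M (s i)) \<longlonglongrightarrow> x"
    and t: "\<And>i. Bochner_Integration.simple_bochner_integrable M (t i)" "(\<lambda>i. \<integral>\<^sup>+ y. norm (g y - t i y) \<partial>M) \<longlonglongrightarrow> 0"
      "(\<lambda>i. Bochner_Integration.simple_bochner_integral M (t i)) \<longlonglongrightarrow> y"
    unfolding has_Bochner_integral_def by blast
  have sf: "simple_function M (s i)" "simple_function M (t i)" for i
    using s t by (auto elim: simple_bochner_integrable.cases)
  note [measurable] = borel_measurable_diff_simple_function[OF m(1) sf(1)]
    borel_measurable_diff_simple_function[OF m(2) sf(2)]
  have le: "(\<integral>\<^sup>+ z. norm (f z + g z - (s i z + t i z)) \<partial>M) \<le>
      (\<integral>\<^sup>+ y. norm (f y - s i y) \<partial>M) + (\<integral>\<^sup>+ y. norm (g y - t i y) \<partial>M)" for i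
  proof -
    have "(\<integral>\<^sup>+ z. norm (f z + g z - (s i z + t i z)) \<partial>M) \<le>
      (\<integral>\<^sup>+ y. ennreal (norm (f y - s i y)) + ennreal (norm (g y - t i y)) \<partial>M)"
      by (intro nn_integral_mono)
        (auto simp flip: ennreal_plus simp: norm_diff_triangle_ineq)
    also have "\<dots> = (\<integral>\<^sup>+ y. norm (f y - s i y) \<partial>M) + (\<integral>\<^sup>+ y. norm (g y - t i y) \<partial>M)"
      by (rule nn_integral_add) auto
    finally show ?thesis .
  qed
  have lim: "(\<lambda>i. (\<integral>\<^sup>+ y. norm (f y - s i y) \<partial>M) + (\<integral>\<^sup>+ y. norm (g y - t i y) \<partial>M)) \<longlonglongrightarrow> 0"
    using tendsto_add[OF s(2) t(2)] by simp
  have lim': "(\<lambda>i. \<integral>\<^sup>+ z. norm (f z + g z - (s i z + t i z)) \<partial>M) \<longlonglongrightarrow> 0"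
    by (rule tendsto_sandwich[OF _ _ tendsto_const lim]) (use le in auto)
  have "(\<lambda>i. Bochner_Integration.simple_bochner_integral M (\<lambda>z. s i z + t i z)) \<longlonglongrightarrow> x + y"
    using tendsto_add[OF s(3) t(3)] s t by (simp add: simple_bochner_integral_add)
  moreover have "Bochner_Integration.simple_bochner_integrable M (\<lambda>z. s i z + t i z)" for i
    using simple_bochner_integrable_compose2[of "(+)" M "s i" "t i"] s t by auto
  ultimately show ?thesis
    unfolding has_Bochner_integral_def using fg lim'
    by (intro conjI exI[of _ "\<lambda>i z. s i z + t i z"]) auto
qed

text \<open>Composition with the measure-preserving map \<open>T\<close> keeps the measures of all
  level sets of a simple function, and surjectivity keeps its range, so the finite sums defining the
  simple integrals coincide.\<close>

lemma has_Bochner_integral_distr: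
  fixes f :: "'b \<Rightarrow> 'c::real_normed_vector"
  assumes T: "T \<in> measurable M N" and N: "distr M N T = N" and surj: "T ` space M = space N"
    and f: "has_Bochner_integral N f x"
  shows "has_Bochner_integral M (\<lambda>y. f (T y)) x"
proof -
  from f obtain s where m: "f \<in> borel_measurable N"
    and s: "\<And>i. Bochner_Integration.simple_bochner_integrable N (s i)" "(\<lambda>i. \<integral>\<^sup>+ y. norm (f y - s i y) \<partial>N) \<longlonglongrightarrow> 0"
      "(\<lambda>i. Bochner_Integration.simple_bochner_integral N (s i)) \<longlonglongrightarrow> x"
    unfolding has_Bochner_integral_def by blast
  have sf: "simple_function N (s i)" for i
    using s by (auto elim: simple_bochner_integrable.cases)
  note [measurable] = borel_measurable_diff_simple_function[OF m sf]
  have vimage: "emeasure M (T -` A \<inter> space M) = emeasure N A" if "A \<in> sets N" for A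
    using emeasure_distr[OF T that] N by simp
  have sets: "{y \<in> space N. s i y = c} \<in> sets N" "{y \<in> space N. s i y \<noteq> 0} \<in> sets N" for i c
    using simple_functionD(2)[OF sf, of i "{c}"] simple_functionD(2)[OF sf, of i "- {0}"]
    by (auto simp: vimage_def Int_def conj_commute)
  have sbi: "Bochner_Integration.simple_bochner_integrable M (\<lambda>y. s i (T y))" for i
  proof
    show "simple_function M (\<lambda>y. s i (T y))"
      by (rule simple_function_comp[OF T sf])
    have "{y \<in> space M. s i (T y) \<noteq> 0} = T -` {y \<in> space N. s i y \<noteq> 0} \<inter> space M"
      using measurable_space[OF T] by auto
    then show "emeasure M {y \<in> space M. s i (T y) \<noteq> 0} \<noteq> \<infinity>"
      using vimage[OF sets(2)] s(1)[of i] by (auto elim: simple_bochner_integrable.cases)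
  qed
  have eq: "Bochner_Integration.simple_bochner_integral M (\<lambda>y. s i (T y)) = Bochner_Integration.simple_bochner_integral N (s i)" for i
  proof -
    have "measure M {y \<in> space M. s i (T y) = c} = measure N {y \<in> space N. s i y = c}" for c
    proof -
      have "{y \<in> space M. s i (T y) = c} = T -` {y \<in> space N. s i y = c} \<inter> space M"
        using measurable_space[OF T] by auto
      then show ?thesis
        using vimage[OF sets(1)] by (simp add: measure_def)
    qed
    moreover have "(\<lambda>y. s i (T y)) ` space M = s i ` space N"
      unfolding surj[symmetric] image_image ..
    ultimately show ?thesis
      unfolding simple_bochner_integral_def by simp
  qed
  have nn: "(\<integral>\<^sup>+ y. norm (f (T y) - s i (T y)) \<partial>M) = (\<integral>\<^sup>+ y. norm (f y - s i y) \<partial>N)" for i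
    using nn_integral_distr[OF T, of "\<lambda>y. ennreal (norm (f y - s i y))"] N by simp
  have "(\<lambda>y. f (T y)) \<in> borel_measurable M"
    by (rule measurable_compose[OF T m])
  then show ?thesis
    unfolding has_Bochner_integral_def
    using sbi s(2,3) by (intro conjI exI[of _ "\<lambda>i y. s i (T y)"]) (simp_all add: eq nn)
qed

section \<open>Strong measurability and Bochner integrability over complete measures\<close>

context complete_measure begin

text \<open>Preimages under \<open>f\<close> and \<open>h\<close> differ only by subsets of a null
  set, and completeness makes those measurable.\<close>

lemma borel_measurable_AE_eq:
  assumes h: "h \<in> borel_measurable M" and eq: "AE x in M. f x = h x"
  shows "f \<in> borel_measurable M"
proof (rule measurableI)
  fix A :: "'b set" assume A: "A \<in> sets borel"
  have "{x \<in> space M. f x \<noteq> h x} \<in> null_sets M"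
    using eq by (simp add: AE_iff_null_sets)
  note null = complete2[OF _ this]
  have *: "f -` A \<inter> space M =
      (h -` A \<inter> space M - {x \<in> space M. f x \<noteq> h x \<and> f x \<notin> A}) \<union> {x \<in> space M. f x \<noteq> h x \<and> f x \<in> A}"
    by auto
  show "f -` A \<inter> space M \<in> sets M"
    unfolding * by (intro sets.Un sets.Diff null_setsD2 null measurable_sets[OF h A]) auto
qed simp

text \<open>After replacing all values on the exceptional null set by 0, the simple functions
  converge everywhere, and pointwise limits of Borel functions into a metric space are Borel.
  Completeness then restores the original values.\<close>

lemma strongly_measurable_imp_borel_measurable:
  fixes f :: "'a \<Rightarrow> 'b::real_normed_vector"
  assumes "strongly_measurable M f"
  shows "f \<in> borel_measurable M"
proof -
  from assms obtain s where s: "\<And>i. simple_function M (s i)" "AE x in M. (\<lambda>i. s i x) \<longlonglongrightarrow> f x"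
    unfolding strongly_measurable_def by blast
  define N where "N = {x \<in> space M. \<not> (\<lambda>i. s i x) \<longlonglongrightarrow> f x}"
  have N: "N \<in> null_sets M"
    using s(2) by (simp add: AE_iff_null_sets N_def)
  have "(\<lambda>x. if x \<in> N then 0 else f x) \<in> borel_measurable M"
  proof (rule borel_measurable_LIMSEQ_metric)
    show "(\<lambda>x. if x \<in> N then 0 else s i x) \<in> borel_measurable M" for i
      using N s(1) by (intro borel_measurable_simple_function simple_function_If_set) auto
    show "(\<lambda>i. if x \<in> N then 0 else s i x) \<longlonglongrightarrow> (if x \<in> N then 0 else f x)" if "x \<in> space M" for x
      using that by (auto simp: N_def)
  qed
  moreover have "AE x in M. f x = (if x \<in> N then 0 else f x)"
    using N by (auto intro!: AE_I'[OF N])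
  ultimately show ?thesis
    by (rule borel_measurable_AE_eq)
qed

text \<open>The truncated approximations \<open>s i x\<close> with \<open>norm (s i x) \<le> 2 * norm (f x)\<close> are dominated by
  \<open>f\<close>, so convergence almost everywhere becomes convergence in $L^1$.\<close>

lemma Bochner_integrableI_bounded:
  fixes f :: "'a \<Rightarrow> 'b::banach"
  assumes f: "strongly_measurable M f" and fin: "(\<integral>\<^sup>+x. norm (f x) \<partial>M) < \<infinity>"
  shows "Bochner_integrable M f"
proof -
  have fm: "f \<in> borel_measurable M"
    by (rule strongly_measurable_imp_borel_measurable[OF f])
  then have [measurable]: "(\<lambda>x. norm (f x)) \<in> borel_measurable M"
    by measurable
  from f obtain s where s: "\<And>i. simple_function M (s i)" "AE x in M. (\<lambda>i. s i x) \<longlonglongrightarrow> f x"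
    unfolding strongly_measurable_def by blast
  define u where "u i x = (if norm (s i x) \<le> 2 * norm (f x) then s i x else 0)" for i x
  have [measurable]: "(\<lambda>x. norm (s i x)) \<in> borel_measurable M" for i
    by (rule borel_measurable_simple_function[OF simple_function_compose1[OF s(1)]])
  have u: "simple_function M (u i)" for i
    unfolding u_def[abs_def] by (intro simple_function_If s(1)) measurable
  have u_le: "norm (u i x) \<le> 2 * norm (f x)" for i x
    by (simp add: u_def)
  have sbi: "Bochner_Integration.simple_bochner_integrable M (u i)" for i
  proof (rule simple_bochner_integrableI_bounded[OF u])
    have "(\<integral>\<^sup>+x. norm (u i x) \<partial>M) \<le> (\<integral>\<^sup>+x. 2 * ennreal (norm (f x)) \<partial>M)"
      using u_le by (intro nn_integral_mono) (simp flip: ennreal_mult' ennreal_numeral)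
    also have "\<dots> = 2 * (\<integral>\<^sup>+x. norm (f x) \<partial>M)"
      by (rule nn_integral_cmult) measurable
    also have "\<dots> < \<infinity>"
      using fin by (simp add: ennreal_mult_less_top)
    finally show "(\<integral>\<^sup>+x. norm (u i x) \<partial>M) < \<infinity>" .
  qed
  have u_lim: "AE x in M. (\<lambda>i. ennreal (norm (f x - u i x))) \<longlonglongrightarrow> 0"
    using s(2)
  proof eventually_elim
    case (elim x)
    have "(\<lambda>i. u i x) \<longlonglongrightarrow> f x"
    \<comment> \<open>Where \<open>f x = 0\<close> the truncation forces \<open>u i x = 0\<close>.
      Elsewhere \<open>norm (s i x)\<close> is eventually below \<open>2 * norm (f x)\<close>, so
      the truncation eventually has no effect.\<close>
    proof (cases "f x = 0")
      case True
      then show ?thesis by (simp add: u_def if_distrib cong: if_cong)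
    next
      case False
      have "(\<lambda>i. norm (s i x)) \<longlonglongrightarrow> norm (f x)"
        by (intro tendsto_norm elim)
      then have "\<forall>\<^sub>F i in sequentially. norm (s i x) < 2 * norm (f x)"
        by (rule order_tendstoD) (use False in simp)
      then have "\<forall>\<^sub>F i in sequentially. s i x = u i x"
        by eventually_elim (simp add: u_def)
      from Lim_transform_eventually[OF elim this] show ?thesis .
    qed
    then have "(\<lambda>i. ennreal (norm (f x - u i x))) \<longlonglongrightarrow> ennreal (norm (f x - f x))"
      by (intro tendsto_intros)
    then show ?case by simp
  qed
  note [measurable] = borel_measurable_diff_simple_function[OF fm u]
  have "(\<lambda>i. \<integral>\<^sup>+x. norm (f x - u i x) \<partial>M) \<longlonglongrightarrow> (\<integral>\<^sup>+x. 0 \<partial>M)"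
  proof (rule nn_integral_dominated_convergence[where w="\<lambda>x. 3 * ennreal (norm (f x))"])
    show "AE x in M. ennreal (norm (f x - u j x)) \<le> 3 * ennreal (norm (f x))" for j
    proof (rule AE_I2)
      fix x
      have "norm (f x - u j x) \<le> 3 * norm (f x)"
        using norm_triangle_ineq4[of "f x" "u j x"] u_le[of j x] by linarith
      then show "ennreal (norm (f x - u j x)) \<le> 3 * ennreal (norm (f x))"
        by (simp flip: ennreal_mult' ennreal_numeral)
    qed
    show "(\<integral>\<^sup>+x. 3 * ennreal (norm (f x)) \<partial>M) < \<infinity>"
      using fin by (simp add: nn_integral_cmult ennreal_mult_less_top)
  qed (use u_lim in auto)
  then have lim: "(\<lambda>i. \<integral>\<^sup>+x. norm (f x - u i x) \<partial>M) \<longlonglongrightarrow> 0"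
    by simp
  \<comment> \<open>Convergence in L1 makes the simple integrals Cauchy, and completeness of the
    target space provides the value of the integral.\<close>
  have "Cauchy (\<lambda>i. Bochner_Integration.simple_bochner_integral M (u i))"
  proof (rule metric_CauchyI)
    fix e :: real assume "e > 0"
    then have "\<forall>\<^sub>F i in sequentially. (\<integral>\<^sup>+x. norm (f x - u i x) \<partial>M) < ennreal (e/3)"
      using lim by (intro order_tendstoD(2)[OF lim]) auto
    then obtain K where K: "\<And>i. i \<ge> K \<Longrightarrow> (\<integral>\<^sup>+x. norm (f x - u i x) \<partial>M) < ennreal (e/3)"
      by (auto simp: eventually_sequentially)
    have "dist (Bochner_Integration.simple_bochner_integral M (u i)) (Bochner_Integration.simple_bochner_integral M (u j)) < e"
      if "i \<ge> K" "j \<ge> K" for i j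
    proof -
      have "ennreal (norm (Bochner_Integration.simple_bochner_integral M (u i) - Bochner_Integration.simple_bochner_integral M (u j))) \<le>
          (\<integral>\<^sup>+x. norm (f x - u i x) \<partial>M) + (\<integral>\<^sup>+x. norm (f x - u j x) \<partial>M)"
        by (rule simple_bochner_integral_diff_le[OF fm sbi sbi])
      also have "\<dots> \<le> ennreal (e/3) + ennreal (e/3)"
        by (intro add_mono less_imp_le K that)
      also have "\<dots> = ennreal (2 * e / 3)"
        using \<open>e > 0\<close> by (simp flip: ennreal_plus)
      also have "\<dots> < ennreal e"
        using \<open>e > 0\<close> by (simp add: ennreal_less_iff)
      finally show ?thesis
        using \<open>e > 0\<close> by (simp add: dist_norm ennreal_less_iff)
    qed
    then show "\<exists>K. \<forall>i\<ge>K. \<forall>j\<ge>K. dist (Bochner_Integration.simple_bochner_integral M (u i)) (Bochner_Integration.simple_bochner_integral M (u j)) < e"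
      by blast
  qed
  then obtain x where "(\<lambda>i. Bochner_Integration.simple_bochner_integral M (u i)) \<longlonglongrightarrow> x"
    by (blast dest: Cauchy_convergent convergentD)
  then show ?thesis
    unfolding Bochner_integrable_def has_Bochner_integral_def using fm sbi lim by blast
qed

end

subsection \<open>Strong measurability\<close>

text \<open>The Banach-Steinhaus argument: the closed sets \<open>E m\<close> cover the complete
  space, so by Baire's theorem one of them contains a ball.\<close>

lemma uniform_boundedness:
  fixes A :: "nat \<Rightarrow> 'a::banach \<Rightarrow>\<^sub>L 'b::real_normed_vector"
  assumes bdd: "\<And>x. bounded (range (\<lambda>n. blinfun_apply (A n) x))"
  obtains C where "\<And>n. norm (A n) \<le> C"
proof -
  define E where "E m = {x. \<forall>n. norm (blinfun_apply (A n) x) \<le> real m}" for m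
  have closed: "closed (E m)" for m
    unfolding E_def by (intro closed_Collect_all closed_Collect_le continuous_intros)
  have "\<exists>m. interior (E m) \<noteq> {}"
  proof (rule ccontr)
    assume "\<nexists>m. interior (E m) \<noteq> {}"
    then have "interior (\<Union>(range E)) = {}"
      using Met_TC.metric_Baire_category_alt[of "range E"] closed
      by (auto simp: mcomplete_iff_complete complete_UNIV)
    moreover have "\<Union>(range E) = UNIV"
    proof -
      have "\<exists>m. x \<in> E m" for x
      proof -
        obtain B where "\<And>n. norm (blinfun_apply (A n) x) \<le> B"
          using bdd[of x] by (auto simp: bounded_iff)
        moreover obtain m where "B \<le> real m"
          using real_arch_simple by blast
        ultimately show ?thesis
          by (auto simp: E_def intro: order_trans)
      qed
      then show ?thesis by auto
    qed
    ultimately show False by simp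
  qed
  then obtain m x where "x \<in> interior (E m)"
    by blast
  then obtain r where r: "r > 0" "cball x r \<subseteq> E m"
    by (auto simp: mem_interior_cball)
  have "norm (A n) \<le> 2 * real m / r" for n
  proof (rule norm_blinfun_bound)
    fix y
    show "norm (blinfun_apply (A n) y) \<le> 2 * real m / r * norm y"
    proof (cases "y = 0")
      case False
      \<comment> \<open>Scaling \<open>y\<close> to length \<open>r\<close> keeps
        \<open>x + c *\<^sub>R y\<close> in the ball. The images of this point and of the centre
        both have norm at most \<open>m\<close>, whence the factor 2 for their difference.\<close>
      define c where "c = r / norm y"
      have c: "c > 0"
        using False r by (simp add: c_def)
      have "x + c *\<^sub>R y \<in> E m" "x \<in> E m"
        using r False by (auto intro!: subsetD[OF r(2)] simp: dist_norm c_def)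
      then have "norm (blinfun_apply (A n) (x + c *\<^sub>R y)) \<le> real m" "norm (blinfun_apply (A n) x) \<le> real m"
        by (auto simp: E_def)
      then have "norm (blinfun_apply (A n) (c *\<^sub>R y)) \<le> 2 * real m"
        using norm_triangle_ineq4[of "blinfun_apply (A n) (x + c *\<^sub>R y)" "blinfun_apply (A n) x"]
        by (simp add: blinfun.add_right)
      then show ?thesis
        using c r False by (simp add: blinfun.scaleR_right c_def field_simps)
    qed simp
  qed (use r in simp)
  then show thesis by (rule that)
qed

text \<open>Split \<open>A n (y n)\<close> into \<open>A n (y n - z)\<close> and
  \<open>A n z\<close>; the first part vanishes in the limit since the operator norms are uniformly
  bounded.\<close>

lemma tendsto_blinfun_apply_strong:
  fixes A :: "nat \<Rightarrow> 'a::banach \<Rightarrow>\<^sub>L 'b::real_normed_vector"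
  assumes A: "\<And>x. (\<lambda>n. blinfun_apply (A n) x) \<longlonglongrightarrow> blinfun_apply B x" and y: "y \<longlonglongrightarrow> z"
  shows "(\<lambda>n. blinfun_apply (A n) (y n)) \<longlonglongrightarrow> blinfun_apply B z"
proof -
  obtain C where C: "\<And>n. norm (A n) \<le> C"
    using uniform_boundedness[of A] A by (blast intro: convergent_imp_bounded)
  have "(\<lambda>n. blinfun_apply (A n) (y n - z)) \<longlonglongrightarrow> 0"
  proof (rule Lim_null_comparison)
    show "\<forall>\<^sub>F n in sequentially. norm (blinfun_apply (A n) (y n - z)) \<le> C * norm (y n - z)"
      using C by (intro always_eventually allI order_trans[OF norm_blinfun] mult_right_mono) auto
    show "(\<lambda>n. C * norm (y n - z)) \<longlonglongrightarrow> 0"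
      using y by (intro tendsto_mult_right_zero tendsto_norm_zero) (simp add: LIM_zero)
  qed
  from tendsto_add[OF this A[of z]] show ?thesis
    by (simp add: blinfun.diff_right)
qed

section \<open>Closure properties of strong measurability\<close>

lemma complete_measure_lebesgue_on:
  "S \<in> sets lebesgue \<Longrightarrow> complete_measure (lebesgue_on S)"
  by standard
    (auto simp: null_sets_restrict_space sets_restrict_space_iff
      intro: null_setsD2 completion.complete2)

text \<open>Applying \<open>h\<close> to two simple functions gives a simple function, and joint
  continuity carries the almost everywhere limits through \<open>h\<close>.\<close>

lemma strongly_measurable_compose2:
  assumes f: "strongly_measurable M f" and g: "strongly_measurable M g"
    and h: "\<And>x y. isCont (\<lambda>z. h (fst z) (snd z)) (x, y)"
  shows "strongly_measurable M (\<lambda>x. h (f x) (g x))"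
proof -
  from f g obtain s t where s: "\<And>i. simple_function M (s i)" "AE x in M. (\<lambda>i. s i x) \<longlonglongrightarrow> f x"
    and t: "\<And>i. simple_function M (t i)" "AE x in M. (\<lambda>i. t i x) \<longlonglongrightarrow> g x"
    unfolding strongly_measurable_def by blast
  have "AE x in M. (\<lambda>i. h (s i x) (t i x)) \<longlonglongrightarrow> h (f x) (g x)"
    using s(2) t(2)
  proof eventually_elim
    case (elim x)
    show ?case
      using isCont_tendsto_compose[OF h tendsto_Pair[OF elim]] by simp
  qed
  then show ?thesis
    unfolding strongly_measurable_def using simple_function_compose2[OF s(1) t(1), of h]
    by (intro exI[of _ "\<lambda>i x. h (s i x) (t i x)"]) auto
qed

lemma strongly_measurable_add:
  "strongly_measurable M f \<Longrightarrow> strongly_measurable M g \<Longrightarrow> strongly_measurable M (\<lambda>x. f x + g x)"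
  by (rule strongly_measurable_compose2) (auto intro!: continuous_intros)

lemma strongly_measurable_diff:
  "strongly_measurable M f \<Longrightarrow> strongly_measurable M g \<Longrightarrow> strongly_measurable M (\<lambda>x. f x - g x)"
  by (rule strongly_measurable_compose2) (auto intro!: continuous_intros)

lemma strongly_measurable_distr:
  assumes f: "strongly_measurable N f" and T: "T \<in> measurable M N" and N: "distr M N T = N"
  shows "strongly_measurable M (\<lambda>x. f (T x))"
proof -
  from f obtain s where s: "\<And>i. simple_function N (s i)" "AE x in N. (\<lambda>i. s i x) \<longlonglongrightarrow> f x"
    unfolding strongly_measurable_def by blast
  have "AE x in M. (\<lambda>i. s i (T x)) \<longlonglongrightarrow> f (T x)"
    by (rule AE_distrD[OF T]) (unfold N, rule s(2))
  then show ?thesis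
    unfolding strongly_measurable_def using simple_function_comp[OF T s(1)]
    by (intro exI[of _ "\<lambda>i x. s i (T x)"]) auto
qed

lemma strongly_measurable_lebesgue_on:
  assumes f: "strongly_measurable lebesgue f" and S: "S \<in> sets lebesgue"
  shows "strongly_measurable (lebesgue_on S) f"
proof -
  from f obtain s where s: "\<And>i. simple_function lebesgue (s i)" "AE x in lebesgue. (\<lambda>i. s i x) \<longlonglongrightarrow> f x"
    unfolding strongly_measurable_def by blast
  have "simple_function (lebesgue_on S) (s i)" for i
    by (rule simple_function_comp[OF _ s(1)]) (simp add: measurable_restrict_space1)
  moreover have "AE x in lebesgue_on S. (\<lambda>i. s i x) \<longlonglongrightarrow> f x"
    using s(2) S by (auto simp: AE_restrict_space_iff)
  ultimately show ?thesis
    unfolding strongly_measurable_def by blast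
qed

lemma strongly_measurable_blinfun_apply:
  fixes R :: "real \<Rightarrow> 'a::banach \<Rightarrow>\<^sub>L 'b::real_normed_vector"
  assumes R: "\<And>x. continuous_on {0<..} (\<lambda>t. blinfun_apply (R t) x)"
    and h: "strongly_measurable (lebesgue_on {0<..}) h"
  shows "strongly_measurable (lebesgue_on {0<..}) (\<lambda>t. blinfun_apply (R t) (h t))"
proof -
  let ?M = "lebesgue_on {0<..} :: real measure"
  from h obtain s where s: "\<And>i. simple_function ?M (s i)" "AE x in ?M. (\<lambda>i. s i x) \<longlonglongrightarrow> h x"
    unfolding strongly_measurable_def by blast
  \<comment> \<open>The identity is approximated by simple functions, so that
    \<open>R (r i x)\<close> takes only finitely many operators as values and
    \<open>R (r i x)\<close> applied to \<open>s i x\<close> is simple.\<close>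
  obtain r where r: "\<And>i. simple_function ?M (r i)" "\<And>x. x \<in> {0<..} \<Longrightarrow> (\<lambda>i. r i x) \<longlonglongrightarrow> x"
    using borel_measurable_implies_sequence_metric[of id ?M 0] by auto
  have "AE x in ?M. (\<lambda>i. blinfun_apply (R (r i x)) (s i x)) \<longlonglongrightarrow> blinfun_apply (R x) (h x)"
    using s(2) AE_space
  proof eventually_elim
    case (elim x)
    then have x: "x \<in> {0<..}"
      by simp
    then have "isCont (\<lambda>t. blinfun_apply (R t) z) x" for z
      using R[of z] by (simp add: continuous_on_eq_continuous_at)
    then have "(\<lambda>i. blinfun_apply (R (r i x)) z) \<longlonglongrightarrow> blinfun_apply (R x) z" for z
      using r(2)[OF x] by (rule isCont_tendsto_compose)
    then show ?case
      using elim(1) by (rule tendsto_blinfun_apply_strong)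
  qed
  then show ?thesis
    unfolding strongly_measurable_def
    using simple_function_compose2[OF r(1) s(1), of "\<lambda>u v. blinfun_apply (R u) v"]
    by (intro exI[of _ "\<lambda>i x. blinfun_apply (R (r i x)) (s i x)"]) auto
qed

text \<open>The operator norm is a supremum of quotients \<open>norm (R t x) / norm x\<close>, each
  continuous in \<open>t\<close>, hence it is lower semicontinuous; the superlevel set is a union of
  open sets over the test vectors \<open>x\<close>.\<close>

lemma open_blinfun_norm_greater:
  fixes R :: "real \<Rightarrow> 'a::real_normed_vector \<Rightarrow>\<^sub>L 'b::real_normed_vector"
  assumes "open S" and R: "\<And>x. continuous_on S (\<lambda>t. blinfun_apply (R t) x)"
  shows "open {t \<in> S. c < norm (R t)}"
proof (cases "c < 0")
  case True
  then have "{t \<in> S. c < norm (R t)} = S"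
    using less_le_trans[OF True norm_ge_zero] by auto
  then show ?thesis using assms by simp
next
  case False
  have "{t \<in> S. c < norm (R t)} = (\<Union>x. {t \<in> S. c * norm x < norm (blinfun_apply (R t) x)})"
  proof (intro equalityI subsetI)
    fix t assume t: "t \<in> {t \<in> S. c < norm (R t)}"
    then have "\<exists>x. \<not> norm (blinfun_apply (R t) x) \<le> c * norm x"
      using norm_blinfun_bound[of c "R t"] False by fastforce
    then show "t \<in> (\<Union>x. {t \<in> S. c * norm x < norm (blinfun_apply (R t) x)})"
      using t by (auto simp: not_le)
  next
    fix t assume "t \<in> (\<Union>x. {t \<in> S. c * norm x < norm (blinfun_apply (R t) x)})"
    then obtain x where x: "t \<in> S" "c * norm x < norm (blinfun_apply (R t) x)"
      by auto
    then have "c * norm x < norm (R t) * norm x"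
      using norm_blinfun[of "R t" x] by linarith
    then show "t \<in> {t \<in> S. c < norm (R t)}"
      using x by (simp add: mult_less_cancel_right)
  qed
  also have "open \<dots>"
  proof (intro open_UN ballI)
    fix x
    have "open ((\<lambda>t. norm (blinfun_apply (R t) x)) -` {c * norm x<..} \<inter> S)"
      by (rule continuous_on_open_vimage[OF \<open>open S\<close>, THEN iffD1, rule_format])
        (auto intro!: continuous_intros R)
    then show "open {t \<in> S. c * norm x < norm (blinfun_apply (R t) x)}"
      by (simp add: vimage_def Int_def conj_commute)
  qed
  finally show ?thesis .
qed

text \<open>The half-line includes 0 because the first interval of the series is [0,1]. The value
  \<open>R 0\<close> is arbitrary, but it affects a superlevel set only by a single point.\<close>

lemma borel_measurable_norm_blinfun:
  fixes R :: "real \<Rightarrow> 'a::real_normed_vector \<Rightarrow>\<^sub>L 'b::real_normed_vector"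
  assumes R: "\<And>x. continuous_on {0<..} (\<lambda>t. blinfun_apply (R t) x)"
  shows "(\<lambda>t. norm (R t)) \<in> borel_measurable (lebesgue_on {0..})"
proof (unfold borel_measurable_iff_greater, intro allI)
  fix c
  have "{t \<in> {0..}. c < norm (R t)} = {t \<in> {0<..}. c < norm (R t)} \<union> {t \<in> {0}. c < norm (R t)}"
    by auto
  also have "\<dots> \<in> sets lebesgue"
  proof (rule sets.Un)
    show "{t \<in> {0<..}. c < norm (R t)} \<in> sets lebesgue"
      using open_blinfun_norm_greater[OF open_greaterThan R] by (metis borel_open sets_completionI_sets sets_lborel)
    have "finite {t \<in> {0}. c < norm (R t)}"
      by simp
    then show "{t \<in> {0}. c < norm (R t)} \<in> sets lebesgue"
      by (metis borel_closed finite_imp_closed sets_completionI_sets sets_lborel)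
  qed
  finally show "{t \<in> space (lebesgue_on {0..}). c < norm (R t)} \<in> sets (lebesgue_on {0..})"
    by (simp add: sets_restrict_space_iff subset_iff)
qed

subsection \<open>The inequalities of Minkowski and Hoelder\<close>

lemma Lp_norm_real:
  "Lp_norm (ennreal p) M f =
    (if (\<integral>\<^sup>+ x. ennreal (norm (f x) powr p) \<partial>M) = \<infinity> then \<infinity>
     else ennreal (enn2real (\<integral>\<^sup>+ x. ennreal (norm (f x) powr p) \<partial>M) powr (1 / p)))"
  if "0 \<le> p"
  using that by (simp add: Lp_norm_def Let_def)

text \<open>Removes the p-th root and the case distinction in the norm, so that bounds can be proved
  as bounds on integrals.\<close>

lemma Lp_norm_le_iff:
  assumes "0 < p" "0 \<le> c"
  shows "Lp_norm (ennreal p) M f \<le> ennreal c \<longleftrightarrow>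
    (\<integral>\<^sup>+ x. ennreal (norm (f x) powr p) \<partial>M) \<le> ennreal (c powr p)"
proof (cases "\<integral>\<^sup>+ x. ennreal (norm (f x) powr p) \<partial>M")
  case (real I)
  have "I powr (1 / p) \<le> c \<longleftrightarrow> I \<le> c powr p"
  proof
    assume "I powr (1 / p) \<le> c"
    then have "(I powr (1 / p)) powr p \<le> c powr p"
      using assms by (intro powr_mono2) auto
    then show "I \<le> c powr p"
      using assms real by (simp add: powr_powr)
  next
    assume "I \<le> c powr p"
    then have "I powr (1 / p) \<le> (c powr p) powr (1 / p)"
      using assms real by (intro powr_mono2) auto
    then show "I powr (1 / p) \<le> c"
      using assms by (simp add: powr_powr)
  qed
  then show ?thesis
    using real assms by (simp add: Lp_norm_real ennreal_le_iff)
next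
  case top
  then show ?thesis
    using assms by (simp add: Lp_norm_real top_unique)
qed

lemma Lp_norm_uminus: "Lp_norm p M (\<lambda>x. - f x) = Lp_norm p M f"
  by (simp add: Lp_norm_def)

lemma Lp_norm_distr:
  assumes T: "T \<in> measurable M N" and N: "distr M N T = N"
    and f: "(\<lambda>x. norm (f x)) \<in> borel_measurable N" and "0 \<le> p"
  shows "Lp_norm (ennreal p) M (\<lambda>x. f (T x)) = Lp_norm (ennreal p) N f"
proof -
  have "(\<integral>\<^sup>+ x. ennreal (norm (f (T x)) powr p) \<partial>M) = (\<integral>\<^sup>+ x. ennreal (norm (f x) powr p) \<partial>N)"
    using nn_integral_distr[OF T, of "\<lambda>x. ennreal (norm (f x) powr p)"] f N by simp
  then show ?thesis
    using \<open>0 \<le> p\<close> by (simp add: Lp_norm_real)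
qed

text \<open>For positive arguments this is convexity of the power. If one argument vanishes, it
  reduces to \<open>v powr p \<le> v\<close> for a weight \<open>v\<close> in [0,1].\<close>

lemma powr_convex_combination_le:
  fixes x y u :: real
  assumes p: "1 \<le> p" and xy: "0 \<le> x" "0 \<le> y" and u: "0 \<le> u" "u \<le> 1"
  shows "((1 - u) * x + u * y) powr p \<le> (1 - u) * x powr p + u * y powr p"
proof (cases "x = 0 \<or> y = 0")
  case True
  have *: "(v * z) powr p \<le> v * z powr p" if "0 \<le> v" "v \<le> 1" "0 \<le> z" for v z :: real
  proof (cases "v = 0")
    case False
    have "v powr p \<le> v powr 1"
      using that p False by (intro powr_mono') auto
    then have "v powr p * z powr p \<le> v * z powr p"
      using that False by (intro mult_right_mono) auto
    then show ?thesis
      using that by (simp add: powr_mult)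
  qed simp
  show ?thesis
    using True *[of "1 - u" x] *[of u y] xy u by auto
next
  case False
  then show ?thesis
    using convex_onD[OF powr_convex[OF p], of u x y] xy u by simp
qed

text \<open>By convexity of the power function, applied to
  $(x + y)/(a + b) = \frac{a}{a+b}\cdot\frac{x}{a} + \frac{b}{a+b}\cdot\frac{y}{b}$.\<close>

lemma Lp_norm_add_le:
  fixes f g :: "'a \<Rightarrow> 'b::real_normed_vector"
  assumes p: "1 \<le> p" and ab: "0 < a" "0 < b"
    and [measurable]: "(\<lambda>x. norm (f x)) \<in> borel_measurable M" "(\<lambda>x. norm (g x)) \<in> borel_measurable M"
    and f: "Lp_norm (ennreal p) M f \<le> ennreal a" and g: "Lp_norm (ennreal p) M g \<le> ennreal b"
  shows "Lp_norm (ennreal p) M (\<lambda>x. f x + g x) \<le> ennreal (a + b)"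
proof -
  \<comment> \<open>The convexity weights times the normalising factors, so that
    \<open>\<alpha> * a powr p + \<beta> * b powr p = (a + b) powr p\<close>.\<close>
  define \<alpha> where "\<alpha> = (a + b) powr p * (a / (a + b)) / a powr p"
  define \<beta> where "\<beta> = (a + b) powr p * (b / (a + b)) / b powr p"
  have nn: "0 \<le> \<alpha>" "0 \<le> \<beta>"
    using ab by (simp_all add: \<alpha>_def \<beta>_def)
  have le: "norm (f x + g x) powr p \<le> \<alpha> * norm (f x) powr p + \<beta> * norm (g x) powr p" for x
  proof -
    let ?x = "norm (f x)" and ?y = "norm (g x)"
    have one: "1 - b / (a + b) = a / (a + b)"
      using ab by (simp add: field_simps)
    have "norm (f x + g x) powr p \<le> (?x + ?y) powr p"
      using p by (intro powr_mono2 norm_triangle_ineq) auto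
    also have "?x + ?y = (a + b) * ((1 - b / (a + b)) * (?x / a) + b / (a + b) * (?y / b))"
      using ab by (simp add: one distrib_left)
    also have "\<dots> powr p = (a + b) powr p * ((1 - b / (a + b)) * (?x / a) + b / (a + b) * (?y / b)) powr p"
      using ab by (intro powr_mult)
    also have "\<dots> \<le> (a + b) powr p * ((1 - b / (a + b)) * (?x / a) powr p + b / (a + b) * (?y / b) powr p)"
      using ab by (intro mult_left_mono powr_convex_combination_le p) auto
    also have "(a + b) powr p * ((1 - b / (a + b)) * (?x / a) powr p + b / (a + b) * (?y / b) powr p) =
        \<alpha> * ?x powr p + \<beta> * ?y powr p"
      using ab by (simp add: one \<alpha>_def \<beta>_def powr_divide distrib_left)
    finally show ?thesis .
  qed
  have "(\<integral>\<^sup>+ x. ennreal (norm (f x + g x) powr p) \<partial>M) \<le>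
      (\<integral>\<^sup>+ x. ennreal \<alpha> * ennreal (norm (f x) powr p) + ennreal \<beta> * ennreal (norm (g x) powr p) \<partial>M)"
    using le nn by (intro nn_integral_mono) (simp flip: ennreal_mult ennreal_plus)
  also have "\<dots> = ennreal \<alpha> * (\<integral>\<^sup>+ x. ennreal (norm (f x) powr p) \<partial>M) +
      ennreal \<beta> * (\<integral>\<^sup>+ x. ennreal (norm (g x) powr p) \<partial>M)"
    by (simp add: nn_integral_add nn_integral_cmult)
  also have "\<dots> \<le> ennreal \<alpha> * ennreal (a powr p) + ennreal \<beta> * ennreal (b powr p)"
    using f g p ab by (intro add_mono mult_left_mono) (simp_all add: Lp_norm_le_iff)
  also have "\<dots> = ennreal (\<alpha> * a powr p + \<beta> * b powr p)"
    using nn by (simp add: ennreal_mult)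
  also have "\<alpha> * a powr p + \<beta> * b powr p = (a + b) powr p * (a / (a + b) + b / (a + b))"
    using ab by (simp add: \<alpha>_def \<beta>_def distrib_left)
  also have "a / (a + b) + b / (a + b) = 1"
    using ab by (simp flip: add_divide_distrib)
  finally show ?thesis
    using p ab by (simp add: Lp_norm_le_iff del: ennreal_plus)
qed

text \<open>In \<open>ennreal\<close>, 1/\<infinity> is 0 and 1/0 is \<infinity>, so the single
  equation admits the endpoint pair and excludes \<open>q = 0\<close>. The split separates the
  essential supremum from the exponents to which Young's inequality applies.\<close>

lemma conjugate_exponents_cases:
  assumes p: "1 \<le> p" and pq: "1 / ennreal p + 1 / q = 1"
  obtains "p = 1" "q = \<infinity>" | q' where "1 < p" "1 < q'" "q = ennreal q'" "1 / p + 1 / q' = 1"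
proof (cases "p = 1")
  case True
  then have "1 + 1 / q = 1 + 0"
    using pq by simp
  then have "1 / q = 0"
    by (subst (asm) ennreal_add_left_cancel) simp
  then show ?thesis
    using that(1) True by (simp add: divide_ennreal_def)
next
  case False
  then have "1 < p" using p by simp
  have inv: "1 / ennreal p = ennreal (1 / p)"
    using p by (simp add: divide_ennreal flip: ennreal_1)
  show ?thesis
  proof (cases q)
    case (real q')
    have "q' \<noteq> 0"
      using pq real by (auto simp: ennreal_divide_zero divide_ennreal_def)
    then have "0 < q'" using real by simp
    then have "1 / q = ennreal (1 / q')"
      using real by (simp add: divide_ennreal flip: ennreal_1)
    then have "ennreal (1 / p + 1 / q') = ennreal 1"
      using pq inv p \<open>0 < q'\<close> by simp
    then have eq: "1 / p + 1 / q' = 1"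
      using p \<open>0 < q'\<close> by (subst (asm) ennreal_inj) auto
    moreover have "1 < q'"
    proof -
      have "1 / q' < 1" using eq p by (smt (verit) divide_pos_pos)
      then show ?thesis using \<open>0 < q'\<close> by (simp add: field_simps)
    qed
    ultimately show ?thesis
      using that(2) \<open>1 < p\<close> real by blast
  next
    case top
    then have "ennreal (1 / p) = ennreal 1"
      using pq inv by simp
    then show ?thesis
      using False p by (subst (asm) ennreal_inj) auto
  qed
qed

text \<open>For \<open>p = 1\<close> the factor \<open>norm (f x)\<close> is almost everywhere below
  its essential supremum. Otherwise Young's inequality is applied to both functions divided by their
  norms and then integrated.\<close>

lemma Lp_norm_Hoelder:
  assumes p: "1 \<le> p" and pq: "1 / ennreal p + 1 / q = 1"
    and [measurable]: "(\<lambda>x. norm (f x)) \<in> borel_measurable M" "(\<lambda>x. norm (g x)) \<in> borel_measurable M"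
  shows "(\<integral>\<^sup>+ x. ennreal (norm (f x) * norm (g x)) \<partial>M) \<le> Lp_norm q M f * Lp_norm (ennreal p) M g"
  using p pq
proof (cases rule: conjugate_exponents_cases)
  case 1
  have "Lp_norm (ennreal p) M g = (\<integral>\<^sup>+ x. ennreal (norm (g x)) \<partial>M)"
    using 1 by (simp add: Lp_norm_def Let_def less_top)
  moreover have "(\<integral>\<^sup>+ x. ennreal (norm (f x) * norm (g x)) \<partial>M) \<le>
      (\<integral>\<^sup>+ x. esssup M (\<lambda>x. ennreal (norm (f x))) * ennreal (norm (g x)) \<partial>M)"
  proof (rule nn_integral_mono_AE)
    show "AE x in M. ennreal (norm (f x) * norm (g x)) \<le> esssup M (\<lambda>x. ennreal (norm (f x))) * ennreal (norm (g x))"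
      using esssup_AE[of "\<lambda>x. ennreal (norm (f x))" M]
      by eventually_elim (simp add: ennreal_mult mult_right_mono)
  qed
  ultimately show ?thesis
    using 1 by (simp add: Lp_norm_def nn_integral_cmult)
next
  case (2 q')
  define I where "I = (\<integral>\<^sup>+ x. ennreal (norm (f x) powr q') \<partial>M)"
  define J where "J = (\<integral>\<^sup>+ x. ennreal (norm (g x) powr p) \<partial>M)"
  have L: "Lp_norm q M f = (if I = \<infinity> then \<infinity> else ennreal (enn2real I powr (1 / q')))"
    "Lp_norm (ennreal p) M g = (if J = \<infinity> then \<infinity> else ennreal (enn2real J powr (1 / p)))"
    using 2 by (simp_all add: Lp_norm_real I_def J_def)
  \<comment> \<open>Normalising requires positive finite norms. If one norm is 0 the product
    vanishes almost everywhere; if none is 0 and one is infinite, the right-hand side is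
    infinite.\<close>
  consider "I = 0 \<or> J = 0" | "I \<noteq> 0" "J \<noteq> 0" "I = \<infinity> \<or> J = \<infinity>"
    | i j where "I = ennreal i" "J = ennreal j" "0 < i" "0 < j"
    by (cases I; cases J) (auto simp: less_le)
  then show ?thesis
  proof cases
    case 1
    then have "AE x in M. norm (f x) * norm (g x) = 0"
      unfolding I_def J_def by (auto simp: nn_integral_0_iff_AE elim: eventually_mono)
    then have "(\<integral>\<^sup>+ x. ennreal (norm (f x) * norm (g x)) \<partial>M) = 0"
      by (subst nn_integral_0_iff_AE) auto
    then show ?thesis by simp
  next
    case 2
    have "Lp_norm q M f \<noteq> 0" "Lp_norm (ennreal p) M g \<noteq> 0"
      using 2 by (auto simp: L enn2real_eq_0_iff)
    moreover have "Lp_norm q M f = \<infinity> \<or> Lp_norm (ennreal p) M g = \<infinity>"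
      using 2 by (auto simp: L)
    ultimately have "Lp_norm q M f * Lp_norm (ennreal p) M g = \<infinity>"
      by (auto simp: ennreal_mult_eq_top_iff)
    then show ?thesis by simp
  next
    case (3 i j)
    define a where "a = i powr (1 / q')"
    define b where "b = j powr (1 / p)"
    have ab: "0 < a" "0 < b" "a powr q' = i" "b powr p = j"
      using 2 3 by (simp_all add: a_def b_def powr_powr)
    have le: "norm (f x) * norm (g x) \<le> a * b / (i * q') * norm (f x) powr q' + a * b / (j * p) * norm (g x) powr p" for x
    proof -
      have "norm (f x) / a * (norm (g x) / b) \<le> (norm (f x) / a) powr q' / q' + (norm (g x) / b) powr p / p"
        using 2 ab by (intro Youngs_inequality) auto
      also have "\<dots> = norm (f x) powr q' / (i * q') + norm (g x) powr p / (j * p)"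
        using ab by (simp add: powr_divide)
      finally have "a * b * (norm (f x) / a * (norm (g x) / b)) \<le>
          a * b * (norm (f x) powr q' / (i * q') + norm (g x) powr p / (j * p))"
        using ab by (intro mult_left_mono) auto
      then show ?thesis
        using ab by (simp add: distrib_left)
    qed
    have "(\<integral>\<^sup>+ x. ennreal (norm (f x) * norm (g x)) \<partial>M) \<le>
        (\<integral>\<^sup>+ x. ennreal (a * b / (i * q')) * ennreal (norm (f x) powr q') +
          ennreal (a * b / (j * p)) * ennreal (norm (g x) powr p) \<partial>M)"
      using le ab 2 3 by (intro nn_integral_mono) (simp flip: ennreal_mult ennreal_plus)
    also have "\<dots> = ennreal (a * b / (i * q')) * I + ennreal (a * b / (j * p)) * J"
      by (simp add: nn_integral_add nn_integral_cmult I_def J_def)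
    also have "\<dots> = ennreal (a * b / (i * q') * i + a * b / (j * p) * j)"
      using 2 3 ab by (simp flip: ennreal_mult ennreal_plus)
    also have "a * b / (i * q') * i + a * b / (j * p) * j = a * b * (1 / p + 1 / q')"
      using 2 3 by (simp add: field_simps)
    also have "\<dots> = a * b"
      using 2 by simp
    also have "ennreal (a * b) = Lp_norm q M f * Lp_norm (ennreal p) M g"
      using 3 ab by (simp add: L a_def b_def ennreal_mult)
    finally show ?thesis .
  qed
qed

subsection \<open>Isometries of the real line\<close>

text \<open>Both kinds of isometry occur below: translations (\<open>c = 1\<close>) and reflections
  (\<open>c = -1\<close>).\<close>

lemma
  fixes c t :: real
  assumes "\<bar>c\<bar> = 1"
  shows measurable_lebesgue_isometry: "(\<lambda>x. t + c * x) \<in> measurable lebesgue lebesgue"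
    and distr_lebesgue_isometry: "distr lebesgue lebesgue (\<lambda>x. t + c * x) = lebesgue"
proof -
  have "c \<noteq> 0" using assms by auto
  then show "(\<lambda>x. t + c * x) \<in> measurable lebesgue lebesgue"
    using lebesgue_affine_measurable[of "\<lambda>_::real. c" t] by simp
  show "distr lebesgue lebesgue (\<lambda>x. t + c * x) = lebesgue"
    using lebesgue_real_affine[OF \<open>c \<noteq> 0\<close>, of t] assms by (simp add: density_1)
qed

text \<open>Measure preservation is inherited by restrictions: for \<open>A\<close> inside
  \<open>S\<close> the whole preimage of \<open>A\<close> lies in the preimage of
  \<open>S\<close>.\<close>

lemma
  fixes T :: "real \<Rightarrow> real"
  assumes T: "T \<in> measurable lebesgue lebesgue" and dT: "distr lebesgue lebesgue T = lebesgue"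
    and S: "S \<in> sets lebesgue"
  shows measurable_lebesgue_on_vimage: "T \<in> measurable (lebesgue_on (T -` S)) (lebesgue_on S)"
    and distr_lebesgue_on_vimage: "distr (lebesgue_on (T -` S)) (lebesgue_on S) T = lebesgue_on S"
proof -
  have TS: "T -` S \<in> sets lebesgue"
    using measurable_sets[OF T S] by simp
  show M: "T \<in> measurable (lebesgue_on (T -` S)) (lebesgue_on S)"
    by (intro measurable_restrict_space2 measurable_restrict_space1 T) auto
  show "distr (lebesgue_on (T -` S)) (lebesgue_on S) T = lebesgue_on S"
  proof (rule measure_eqI)
    fix A assume "A \<in> sets (distr (lebesgue_on (T -` S)) (lebesgue_on S) T)"
    then have A: "A \<in> sets (lebesgue_on S)"
      by simp
    then have A': "A \<in> sets lebesgue" "A \<subseteq> S"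
      using S by (auto simp: sets_restrict_space_iff)
    have "emeasure (distr (lebesgue_on (T -` S)) (lebesgue_on S) T) A = emeasure (lebesgue_on (T -` S)) (T -` A \<inter> T -` S)"
      using emeasure_distr[OF M A] by simp
    also have "\<dots> = emeasure lebesgue (T -` A)"
      using A' TS by (subst emeasure_restrict_space) (auto intro!: arg_cong[of _ _ "emeasure lebesgue"])
    also have "\<dots> = emeasure (distr lebesgue lebesgue T) A"
      using emeasure_distr[OF T A'(1)] by simp
    also have "\<dots> = emeasure (lebesgue_on S) A"
      using A' S unfolding dT by (subst emeasure_restrict_space) auto
    finally show "emeasure (distr (lebesgue_on (T -` S)) (lebesgue_on S) T) A = emeasure (lebesgue_on S) A" .
  qed simp
qed

lemma borel_measurable_norm_strongly_measurable:
  fixes h :: "real \<Rightarrow> 'a::real_normed_vector"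
  assumes "strongly_measurable lebesgue h" "S \<in> sets lebesgue"
  shows "(\<lambda>x. norm (h x)) \<in> borel_measurable (lebesgue_on S)"
proof (rule measurable_compose[OF _ borel_measurable_norm])
  interpret complete_measure "lebesgue_on S"
    by (rule complete_measure_lebesgue_on[OF assms(2)])
  show "h \<in> borel_measurable (lebesgue_on S)"
    by (rule strongly_measurable_imp_borel_measurable[OF strongly_measurable_lebesgue_on[OF assms]])
qed

lemma strongly_measurable_isometry:
  fixes c t :: real
  assumes "strongly_measurable lebesgue h" "\<bar>c\<bar> = 1"
  shows "strongly_measurable lebesgue (\<lambda>x. h (t + c * x))"
  by (rule strongly_measurable_distr[OF assms(1) measurable_lebesgue_isometry distr_lebesgue_isometry])
    (use assms in auto)

lemma Lp_norm_isometry: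
  fixes c t :: real and h :: "real \<Rightarrow> 'a::real_normed_vector"
  assumes h: "strongly_measurable lebesgue h" and c: "\<bar>c\<bar> = 1" and S: "S \<in> sets lebesgue" and p: "0 \<le> p"
  shows "Lp_norm (ennreal p) (lebesgue_on ((\<lambda>x. t + c * x) -` S)) (\<lambda>x. h (t + c * x)) =
    Lp_norm (ennreal p) (lebesgue_on S) h"
  using Lp_norm_distr[OF measurable_lebesgue_on_vimage distr_lebesgue_on_vimage
      borel_measurable_norm_strongly_measurable]
    measurable_lebesgue_isometry[OF c] distr_lebesgue_isometry[OF c] assms
  by blast

text \<open>The substitution \<open>r = a + 1 - u\<close> maps [0,1] onto [a,a+1] and turns
  \<open>t - r\<close> into \<open>t - a - 1 + u\<close>. This is the origin of the shift by 1 in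
  the argument of the lift.\<close>

lemma Lp_norm_reflect_unit_interval:
  fixes h :: "real \<Rightarrow> 'a::real_normed_vector"
  assumes h: "strongly_measurable lebesgue h" and p: "0 \<le> p"
  shows "Lp_norm (ennreal p) (lebesgue_on {a..a + 1}) (\<lambda>r. h (t - r)) =
    Lp_norm (ennreal p) (lebesgue_on {0..1}) (\<lambda>u. h (t - a - 1 + u))"
proof -
  have "strongly_measurable lebesgue (\<lambda>r. h (t - r))"
    using strongly_measurable_isometry[OF h, of "-1" t] by simp
  from Lp_norm_isometry[OF this, of "-1" "{a..a + 1}" p "a + 1"] p
  have "Lp_norm (ennreal p) (lebesgue_on {a..a + 1}) (\<lambda>r. h (t - r)) =
      Lp_norm (ennreal p) (lebesgue_on ((\<lambda>u. a + 1 - u) -` {a..a + 1})) (\<lambda>u. h (t - (a + 1 - u)))"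
    by simp
  also have "(\<lambda>u. a + 1 - u) -` {a..a + 1} = {0..1}"
    by auto
  also have "(\<lambda>u. h (t - (a + 1 - u))) = (\<lambda>u. h (t - a - 1 + u))"
    by (simp add: algebra_simps)
  finally show ?thesis .
qed

subsection \<open>The convolution estimate\<close>

lemma nn_integral_lebesgue_on_Ioi_le:
  fixes f :: "real \<Rightarrow> ennreal"
  assumes f: "f \<in> borel_measurable (lebesgue_on {0..})"
  shows "(\<integral>\<^sup>+ r. f r \<partial>lebesgue_on {0<..}) \<le> (\<Sum>k::nat. \<integral>\<^sup>+ r. f r \<partial>lebesgue_on {real k..real k + 1})"
proof -
  have m: "(\<lambda>r. f r * indicator {0..} r) \<in> borel_measurable lebesgue"
    using f by (subst borel_measurable_restrict_space_iff_ennreal[symmetric]) auto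
  \<comment> \<open>Since \<open>f\<close> is measurable only on the closed half-line, it is first
    extended by 0 to the whole line.\<close>
  have eq: "f r * indicator {real k..real k + 1} r =
      f r * indicator {0..} r * indicator {real k..real k + 1} r" for r and k :: nat
    by (auto split: split_indicator)
  have [measurable]: "(\<lambda>r. f r * indicator {real k..real k + 1} r) \<in> borel_measurable lebesgue" for k
    unfolding eq by (intro borel_measurable_times_ennreal[OF m] borel_measurable_indicator) simp
  have "(\<integral>\<^sup>+ r. f r \<partial>lebesgue_on {0<..}) = (\<integral>\<^sup>+ r. f r * indicator {0<..} r \<partial>lebesgue)"
    by (simp add: nn_integral_restrict_space)
  also have "\<dots> \<le> (\<integral>\<^sup>+ r. (\<Sum>k::nat. f r * indicator {real k..real k + 1} r) \<partial>lebesgue)"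
  proof (rule nn_integral_mono)
    fix r :: real
    show "f r * indicator {0<..} r \<le> (\<Sum>k::nat. f r * indicator {real k..real k + 1} r)"
    proof (cases "r > 0")
      case True
      then have "r \<in> {real (nat \<lfloor>r\<rfloor>)..real (nat \<lfloor>r\<rfloor>) + 1}"
        by auto
      \<comment> \<open>The term at the integer part of \<open>r\<close> alone recovers
        \<open>f r\<close>. Neighbouring closed intervals share an integer endpoint, where the sum
        may exceed it.\<close>
      then have "f r * indicator {0<..} r = (\<Sum>k\<in>{nat \<lfloor>r\<rfloor>}. f r * indicator {real k..real k + 1} r)"
        using True by simp
      also have "\<dots> \<le> (\<Sum>k::nat. f r * indicator {real k..real k + 1} r)"
        by (rule sum_le_suminf) auto
      finally show ?thesis .
    qed simp
  qed
  also have "\<dots> = (\<Sum>k::nat. \<integral>\<^sup>+ r. f r * indicator {real k..real k + 1} r \<partial>lebesgue)"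
    by (rule nn_integral_suminf) measurable
  also have "\<dots> = (\<Sum>k::nat. \<integral>\<^sup>+ r. f r \<partial>lebesgue_on {real k..real k + 1})"
    by (simp add: nn_integral_restrict_space)
  finally show ?thesis .
qed

lemma nn_integral_convolution_le:
  fixes R :: "real \<Rightarrow> 'a::banach \<Rightarrow>\<^sub>L 'b::real_normed_vector"
  assumes p: "1 \<le> p" and pq: "1 / ennreal p + 1 / q = 1"
    and R: "\<And>x. continuous_on {0<..} (\<lambda>t. blinfun_apply (R t) x)"
    and h: "strongly_measurable lebesgue h"
  shows "(\<integral>\<^sup>+ r. norm (blinfun_apply (R r) (h (t - r))) \<partial>lebesgue_on {0<..}) \<le>
    (\<Sum>k::nat. Lp_norm q (lebesgue_on {real k..real k + 1}) (\<lambda>r. norm (R r)) *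
      Lp_norm (ennreal p) (lebesgue_on {0..1}) (Stepanov_lift h (t - real k - 1)))"
proof -
  have h': "strongly_measurable lebesgue (\<lambda>r. h (t - r))"
    using strongly_measurable_isometry[OF h, of "-1" t] by simp
  have mh: "(\<lambda>r. norm (h (t - r))) \<in> borel_measurable (lebesgue_on S)" if "S \<in> sets lebesgue" for S
    using borel_measurable_norm_strongly_measurable[OF h' that] .
  note mR = borel_measurable_norm_blinfun[OF R]
  \<comment> \<open>The doubled norm arises because the Lq-norm is taken of the scalar function
    \<open>norm (R r)\<close>.\<close>
  have mR': "(\<lambda>r. norm (norm (R r))) \<in> borel_measurable (lebesgue_on {real k..real k + 1})" for k :: nat
    using measurable_restrict_mono[OF mR, of "{real k..real k + 1}"] by auto
  have "(\<integral>\<^sup>+ r. norm (blinfun_apply (R r) (h (t - r))) \<partial>lebesgue_on {0<..}) \<le>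
      (\<integral>\<^sup>+ r. ennreal (norm (R r) * norm (h (t - r))) \<partial>lebesgue_on {0<..})"
    by (intro nn_integral_mono ennreal_leI norm_blinfun)
  also have "\<dots> \<le> (\<Sum>k::nat. \<integral>\<^sup>+ r. ennreal (norm (R r) * norm (h (t - r))) \<partial>lebesgue_on {real k..real k + 1})"
  proof (rule nn_integral_lebesgue_on_Ioi_le)
    have "(\<lambda>r. norm (h (t - r))) \<in> borel_measurable (lebesgue_on {0..})"
      by (rule mh) simp
    with mR show "(\<lambda>r. ennreal (norm (R r) * norm (h (t - r)))) \<in> borel_measurable (lebesgue_on {0..})"
      by measurable
  qed
  also have "\<dots> \<le> (\<Sum>k::nat. Lp_norm q (lebesgue_on {real k..real k + 1}) (\<lambda>r. norm (R r)) *
      Lp_norm (ennreal p) (lebesgue_on {real k..real k + 1}) (\<lambda>r. h (t - r)))"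
  proof (rule suminf_le)
    fix k :: nat
    show "(\<integral>\<^sup>+ r. ennreal (norm (R r) * norm (h (t - r))) \<partial>lebesgue_on {real k..real k + 1}) \<le>
        Lp_norm q (lebesgue_on {real k..real k + 1}) (\<lambda>r. norm (R r)) *
        Lp_norm (ennreal p) (lebesgue_on {real k..real k + 1}) (\<lambda>r. h (t - r))"
      using Lp_norm_Hoelder[OF p pq mR'[of k] mh[of "{real k..real k + 1}"]] by simp
  qed auto
  finally show ?thesis
    using p by (simp add: Lp_norm_reflect_unit_interval[OF h] Stepanov_lift_def)
qed

text \<open>Write the lift at \<open>s\<close> as its sum with the lift at
  \<open>s + \<tau>\<close>, minus the latter. For a 1-antiperiod \<tau> with
  \<open>s + \<tau>\<close> in (0,l) the sum has norm at most 1, and local p-integrability bounds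
  the rest.\<close>

lemma Stepanov_lift_bounded:
  fixes g :: "real \<Rightarrow> 'a::real_normed_vector"
  assumes p: "1 \<le> p" and g: "Stepanov_almost_anti_periodic p g"
  obtains C where "0 < C" "\<And>s. Lp_norm (ennreal p) (lebesgue_on {0..1}) (Stepanov_lift g s) \<le> ennreal C"
proof -
  let ?N = "Lp_norm (ennreal p) (lebesgue_on {0..1})"
  have gm: "strongly_measurable lebesgue g"
    and fin: "\<And>K. compact K \<Longrightarrow> Lp_norm (ennreal p) (lebesgue_on K) g < \<infinity>"
    and dense: "relatively_dense (antiperiods_wrt ?N (Stepanov_lift g) 1)"
    using g by (auto simp: Stepanov_almost_anti_periodic_def Lp_loc_def almost_anti_periodic_wrt_def)
  from dense obtain l where l: "l > 0" "\<And>a. {a<..<a + l} \<inter> antiperiods_wrt ?N (Stepanov_lift g) 1 \<noteq> {}"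
    unfolding relatively_dense_def by blast
  \<comment> \<open>The interval [0,l+1] contains every window [s,s+1] with \<open>s\<close> in
    [0,l]. Adding 1 makes the bound positive, as \<open>Lp_norm_add_le\<close> demands.\<close>
  define B where "B = enn2real (Lp_norm (ennreal p) (lebesgue_on {0..l + 1}) g) + 1"
  have B: "0 < B" "Lp_norm (ennreal p) (lebesgue_on {0..l + 1}) g \<le> ennreal B"
    using fin[of "{0..l + 1}"]
    by (cases "Lp_norm (ennreal p) (lebesgue_on {0..l + 1}) g"; simp add: B_def add_nonneg_pos)+
  have lift: "strongly_measurable lebesgue (Stepanov_lift g s)" for s
    using strongly_measurable_isometry[OF gm, of 1 s] by (simp add: Stepanov_lift_def[abs_def])
  have le_B: "?N (Stepanov_lift g s) \<le> ennreal B" if "0 \<le> s" "s \<le> l" for s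
  proof -
    have "{s..s + 1} \<inter> {0..l + 1} = {s..s + 1}"
      using that by auto
    then have "(\<integral>\<^sup>+ x. ennreal (norm (g x) powr p) \<partial>lebesgue_on {s..s + 1}) \<le>
        (\<integral>\<^sup>+ x. ennreal (norm (g x) powr p) \<partial>lebesgue_on {0..l + 1})"
      using that by (simp add: nn_integral_restrict_space)
        (intro nn_integral_mono, auto split: split_indicator)
    also have "\<dots> \<le> ennreal (B powr p)"
      using B p by (simp flip: Lp_norm_le_iff)
    finally have "Lp_norm (ennreal p) (lebesgue_on {s..s + 1}) g \<le> ennreal B"
      using B p by (simp add: Lp_norm_le_iff)
    moreover have "(\<lambda>x. s + 1 * x) -` {s..s + 1} = {0..1}"
      by auto
    ultimately show ?thesis
      using Lp_norm_isometry[OF gm, of 1 "{s..s + 1}" p s] p by (simp add: Stepanov_lift_def)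
  qed
  have "?N (Stepanov_lift g s) \<le> ennreal (1 + B)" for s
  proof -
    \<comment> \<open>Searching in the interval that starts at \<open>-s\<close> places
      \<open>s + \<tau>\<close> between 0 and \<open>l\<close>.\<close>
    obtain \<tau> where \<tau>: "\<tau> \<in> {- s<..<- s + l}" "\<tau> \<in> antiperiods_wrt ?N (Stepanov_lift g) 1"
      using l(2)[of "- s"] by blast
    have "?N (\<lambda>u. (Stepanov_lift g (s + \<tau>) + Stepanov_lift g s) u + - Stepanov_lift g (s + \<tau>) u) \<le> ennreal (1 + B)"
    proof (rule Lp_norm_add_le[OF p _ B(1)])
      show "?N (Stepanov_lift g (s + \<tau>) + Stepanov_lift g s) \<le> ennreal 1"
        using \<tau> by (simp add: antiperiods_wrt_def)
      show "?N (\<lambda>u. - Stepanov_lift g (s + \<tau>) u) \<le> ennreal B"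
        using le_B[of "s + \<tau>"] \<tau> by (simp add: Lp_norm_uminus)
      show "(\<lambda>u. norm (- Stepanov_lift g (s + \<tau>) u)) \<in> borel_measurable (lebesgue_on {0..1})"
        using borel_measurable_norm_strongly_measurable[OF lift] by simp
      show "(\<lambda>u. norm ((Stepanov_lift g (s + \<tau>) + Stepanov_lift g s) u)) \<in> borel_measurable (lebesgue_on {0..1})"
        using borel_measurable_norm_strongly_measurable[OF strongly_measurable_add[OF lift lift]]
        by simp
    qed simp
    then show ?thesis
      by simp
  qed
  then show thesis
    using B by (intro that[of "1 + B"]) auto
qed

lemma relatively_dense_mono:
  assumes "relatively_dense A" "A \<subseteq> B"
  shows "relatively_dense B"
proof -
  obtain l where l: "l > 0" "\<And>a. {a<..<a + l} \<inter> A \<noteq> {}"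
    using assms(1) unfolding relatively_dense_def by blast
  have "{a<..<a + l} \<inter> B \<noteq> {}" for a
    using l(2)[of a] assms(2) by blast
  with l(1) show ?thesis
    unfolding relatively_dense_def by blast
qed

theorem proposition3p1:
  fixes R :: "real \<Rightarrow> 'a::complex_banach \<Rightarrow>\<^sub>L 'a"
    and g :: "real \<Rightarrow> 'a"
    and p :: real and q :: ennreal
  assumes p: "1 \<le> p" and pq: "1 / ennreal p + 1 / q = 1"
    and R: "strongly_continuous_family R"
    and M: "(\<Sum>k::nat. Lp_norm q (lebesgue_on {real k..real k + 1}) (\<lambda>t. norm (R t))) < \<infinity>"
    and g: "Stepanov_almost_anti_periodic p g"
  shows "(\<forall>t. Bochner_integrable (lebesgue_on {..<t}) (\<lambda>s. blinfun_apply (R (t - s)) (g s)))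
    \<and> almost_anti_periodic
        (\<lambda>t. Bochner_integral (lebesgue_on {..<t}) (\<lambda>s. blinfun_apply (R (t - s)) (g s)))"
proof -
  let ?M = "lebesgue_on {0<..} :: real measure"
  define N :: "(real \<Rightarrow> 'a) \<Rightarrow> ennreal" where "N = Lp_norm (ennreal p) (lebesgue_on {0..1})"
  define a where "a k = Lp_norm q (lebesgue_on {real k..real k + 1}) (\<lambda>t. norm (R t))" for k :: nat
  \<comment> \<open>The convolution after the substitution, for a general \<open>h\<close>, so that
    the same bounds apply to sums and differences of translates of \<open>g\<close>.\<close>
  define G where "G h t = Bochner_integral ?M (\<lambda>r. blinfun_apply (R r) (h (t - r)))" for h :: "real \<Rightarrow> 'a" and t
  have Rc: "continuous_on {0<..} (\<lambda>t. blinfun_apply (R t) x)" for x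
    using R by (simp add: strongly_continuous_family_def)
  have gm: "strongly_measurable lebesgue g"
    using g by (simp add: Stepanov_almost_anti_periodic_def Lp_loc_def)
  have gshift: "strongly_measurable lebesgue (\<lambda>x. g (x + c))" for c
    using strongly_measurable_isometry[OF gm, of 1 c] by (simp add: add.commute)
  have lift: "Stepanov_lift (\<lambda>x. g (x + c)) s = Stepanov_lift g (s + c)" for c s
    by (auto simp: Stepanov_lift_def add_ac)
  obtain C where C: "0 < C" "\<And>s. N (Stepanov_lift g s) \<le> ennreal C"
    using Stepanov_lift_bounded[OF p g] unfolding N_def by blast
  interpret complete_measure ?M
    by (rule complete_measure_lebesgue_on) simp

  \<comment> \<open>Existence, norm bound and additivity of the convolution\<close>
  have sm: "strongly_measurable ?M (\<lambda>r. blinfun_apply (R r) (h (t - r)))"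
    if "strongly_measurable lebesgue h" for h t
    using strongly_measurable_isometry[OF that, of "-1" t]
    by (intro strongly_measurable_blinfun_apply[OF Rc] strongly_measurable_lebesgue_on) auto
  have est: "(\<integral>\<^sup>+ r. norm (blinfun_apply (R r) (h (t - r))) \<partial>?M) \<le>
      (\<Sum>k. a k * N (Stepanov_lift h (t - real k - 1)))"
    if "strongly_measurable lebesgue h" for h t
    unfolding a_def N_def by (rule nn_integral_convolution_le[OF p pq Rc that])
  have sum_le: "(\<Sum>k. a k * N (Stepanov_lift h (t - real k - 1))) \<le> (\<Sum>k. a k) * ennreal c"
    if "\<And>s. N (Stepanov_lift h s) \<le> ennreal c" for h t c
  proof -
    have "(\<Sum>k. a k * N (Stepanov_lift h (t - real k - 1))) \<le> (\<Sum>k. a k * ennreal c)"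
      by (intro suminf_le mult_left_mono that) auto
    then show ?thesis by simp
  qed
  have has: "has_Bochner_integral ?M (\<lambda>r. blinfun_apply (R r) (h (t - r))) (G h t)"
    if h: "strongly_measurable lebesgue h" and c: "\<And>s. N (Stepanov_lift h s) \<le> ennreal c" for h t c
  proof -
    have "(\<integral>\<^sup>+ r. norm (blinfun_apply (R r) (h (t - r))) \<partial>?M) \<le> (\<Sum>k. a k) * ennreal c"
      using est[OF h] sum_le[OF c] by (rule order_trans)
    also have "\<dots> < \<infinity>"
      using M by (simp add: a_def ennreal_mult_less_top)
    finally have "Bochner_integrable ?M (\<lambda>r. blinfun_apply (R r) (h (t - r)))"
      by (rule Bochner_integrableI_bounded[OF sm[OF h]])
    then show ?thesis
      by (auto simp: Bochner_integrable_def G_def dest: has_Bochner_integral_integral_eq)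
  qed
  have norm_G: "ennreal (norm (G h t)) \<le> (\<Sum>k. a k * N (Stepanov_lift h (t - real k - 1)))"
    if h: "strongly_measurable lebesgue h" and c: "\<And>s. N (Stepanov_lift h s) \<le> ennreal c" for h t c
    using has_Bochner_integral_norm_le[OF has[OF that]] est[OF h] by (rule order_trans)
  have G_sum: "G (\<lambda>x. h x + h' x) t = G h t + G h' t"
    if h: "strongly_measurable lebesgue h" "\<And>s. N (Stepanov_lift h s) \<le> ennreal c"
      and h': "strongly_measurable lebesgue h'" "\<And>s. N (Stepanov_lift h' s) \<le> ennreal c'" for h h' t c c'
  proof -
    have "has_Bochner_integral ?M (\<lambda>r. blinfun_apply (R r) (h (t - r)) + blinfun_apply (R r) (h' (t - r))) (G h t + G h' t)"
      by (intro has_Bochner_integral_add has[OF h] has[OF h'] strongly_measurable_imp_borel_measurable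
          strongly_measurable_add sm h h')
    then show ?thesis
      by (simp add: G_def[of "\<lambda>x. h x + h' x"] blinfun.add_right has_Bochner_integral_integral_eq)
  qed
  \<comment> \<open>Convolution commutes with translation; hence sums and differences of values of
    \<open>G g\<close> are values of \<open>G\<close> at sums and differences of translates.\<close>
  have G_shift: "G (\<lambda>x. g (x + c)) t = G g (t + c)" for c t
    by (simp add: G_def algebra_simps)

  \<comment> \<open>Return to the integral over the half-line below \<open>t\<close>\<close>
  have int: "has_Bochner_integral (lebesgue_on {..<t}) (\<lambda>s. blinfun_apply (R (t - s)) (g s)) (G g t)" for t
  proof -
    have "\<bar>-1 :: real\<bar> = 1" by simp
    note T = measurable_lebesgue_isometry[OF this, of t] distr_lebesgue_isometry[OF this, of t]
    have vimage: "(\<lambda>x. t - x) -` {0<..} = {..<t}"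
      by auto
    \<comment> \<open>Writing \<open>s\<close> as \<open>t - (t - s)\<close> exhibits the integrand
      as a composition with the reflection at \<open>t\<close>.\<close>
    have "has_Bochner_integral (lebesgue_on {..<t}) (\<lambda>s. blinfun_apply (R (t - s)) (g (t - (t - s)))) (G g t)"
    proof (rule has_Bochner_integral_distr[OF _ _ _ has[OF gm C(2)]])
      show "(-) t \<in> measurable (lebesgue_on {..<t}) ?M" "distr (lebesgue_on {..<t}) ?M ((-) t) = ?M"
        using measurable_lebesgue_on_vimage[OF T, of "{0<..}"] distr_lebesgue_on_vimage[OF T, of "{0<..}"]
        by (simp_all add: vimage)
      show "(-) t ` space (lebesgue_on {..<t}) = space ?M"
        by (auto intro: image_eqI[of _ _ "t - _"])
    qed
    then show ?thesis by simp
  qed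
  then have G_eq: "Bochner_integral (lebesgue_on {..<t}) (\<lambda>s. blinfun_apply (R (t - s)) (g s)) = G g t" for t
    by (rule has_Bochner_integral_integral_eq)

  \<comment> \<open>Antiperiods of the convolution\<close>
  have lift_anti: "Stepanov_lift (\<lambda>x. g (x + c) + g x) s = Stepanov_lift g (s + c) + Stepanov_lift g s"
    and lift_diff: "Stepanov_lift (\<lambda>x. g (x + c) - g x) s = Stepanov_lift g (s + c) - Stepanov_lift g s" for c s
    by (auto simp: Stepanov_lift_def add_ac)

  have dense: "relatively_dense (antiperiods (G g) \<epsilon>)" if "\<epsilon> > 0" for \<epsilon>
  proof -
    define A where "A = enn2real (\<Sum>k. a k)"
    have A: "(\<Sum>k. a k) = ennreal A" "0 \<le> A"
      using M by (auto simp: A_def a_def)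
    \<comment> \<open>Dividing by \<open>A + 1\<close> instead of \<open>A\<close> also covers
      \<open>A = 0\<close>.\<close>
    define \<delta> where "\<delta> = \<epsilon> / (A + 1)"
    have \<delta>: "0 < \<delta>" "A * \<delta> \<le> \<epsilon>"
      using \<open>\<epsilon> > 0\<close> A by (auto simp: \<delta>_def field_simps)
    have "antiperiods_wrt N (Stepanov_lift g) \<delta> \<subseteq> antiperiods (G g) \<epsilon>"
    proof
      fix \<tau> assume \<tau>: "\<tau> \<in> antiperiods_wrt N (Stepanov_lift g) \<delta>"
      let ?h = "\<lambda>x. g (x + \<tau>) + g x"
      have h: "strongly_measurable lebesgue ?h"
        by (intro strongly_measurable_add gshift gm)
      have N_h: "N (Stepanov_lift ?h s) \<le> ennreal \<delta>" for s
        using \<tau> by (simp add: lift_anti antiperiods_wrt_def)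
      have "norm (G g (t + \<tau>) + G g t) \<le> \<epsilon>" for t
      proof -
        have "G ?h t = G g (t + \<tau>) + G g t"
          unfolding G_shift[of \<tau>, symmetric]
          by (rule G_sum[OF gshift _ gm C(2)]) (unfold lift, rule C(2))
        moreover have "ennreal (norm (G ?h t)) \<le> (\<Sum>k. a k) * ennreal \<delta>"
          using norm_G[OF h N_h] sum_le[OF N_h] by (rule order_trans)
        ultimately have "ennreal (norm (G g (t + \<tau>) + G g t)) \<le> ennreal (A * \<delta>)"
          using A \<delta> by (simp add: ennreal_mult)
        then show ?thesis
          using \<delta> A by simp
      qed
      then show "\<tau> \<in> antiperiods (G g) \<epsilon>"
        using \<tau> by (simp add: antiperiods_def antiperiods_wrt_def)
    qed
    moreover have "relatively_dense (antiperiods_wrt N (Stepanov_lift g) \<delta>)"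
      using g \<delta> by (simp add: Stepanov_almost_anti_periodic_def almost_anti_periodic_wrt_def N_def)
    ultimately show ?thesis
      by (blast intro: relatively_dense_mono)
  qed

  \<comment> \<open>Continuity of the convolution\<close>
  have cont: "isCont (G g) t" for t
  proof -
    have "((\<lambda>x. norm (G g x - G g t)) \<longlongrightarrow> 0) (at t)"
    \<comment> \<open>Dominated convergence works along sequences. They avoid \<open>t\<close>,
      which matches the punctured limits in the continuity of the lift.\<close>
    proof (unfold tendsto_at_iff_sequentially comp_def, intro allI impI)
      fix X assume X: "\<forall>i. X i \<in> UNIV - {t}" "X \<longlonglongrightarrow> t"
      define D where "D i k = N (Stepanov_lift g (X i - real k - 1) - Stepanov_lift g (t - real k - 1))" for i k
      have D_eq: "D i k = N (Stepanov_lift (\<lambda>x. g (x + (X i - t)) - g x) (t - real k - 1))" for i k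
        unfolding lift_diff D_def by (simp add: algebra_simps)
      \<comment> \<open>Minkowski's inequality with the bound \<open>C\<close> for each translate
        gives a bound uniform in \<open>c\<close> and \<open>s\<close>, which will dominate the
        series.\<close>
      have D_le: "N (Stepanov_lift (\<lambda>x. g (x + c) - g x) s) \<le> ennreal (C + C)" for c s
      proof -
        have "N (\<lambda>u. Stepanov_lift g (s + c) u + - Stepanov_lift g s u) \<le> ennreal (C + C)"
          unfolding N_def
        proof (rule Lp_norm_add_le[OF p C(1) C(1)])
          have "strongly_measurable lebesgue (Stepanov_lift g s)" for s
            using gshift[of s] by (simp add: Stepanov_lift_def[abs_def] add.commute)
          from borel_measurable_norm_strongly_measurable[OF this]
          show "(\<lambda>u. norm (Stepanov_lift g (s + c) u)) \<in> borel_measurable (lebesgue_on {0..1})"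
            "(\<lambda>u. norm (- Stepanov_lift g s u)) \<in> borel_measurable (lebesgue_on {0..1})"
            by simp_all
        qed (use C in \<open>simp_all add: Lp_norm_uminus N_def\<close>)
        then show ?thesis
          unfolding lift_diff by (simp add: fun_diff_def)
      qed
      have bound: "ennreal (norm (G g (X i) - G g t)) \<le> (\<Sum>k. a k * D i k)" for i
      proof -
        let ?c = "X i - t"
        let ?h = "\<lambda>x. g (x + ?c) - g x"
        have h: "strongly_measurable lebesgue ?h"
          by (intro strongly_measurable_diff gshift gm)
        \<comment> \<open>The sum \<open>?h + g\<close> is the translate of \<open>g\<close>, so
          additivity of \<open>G\<close> also yields its value at the difference.\<close>
        have "G (\<lambda>x. ?h x + g x) t = G ?h t + G g t"
          by (rule G_sum[OF h D_le gm C(2)])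
        then have "G ?h t = G g (X i) - G g t"
          using G_shift[of ?c t] by simp
        then show ?thesis
          using norm_G[OF h D_le, of t] by (simp add: D_eq)
      qed
      have "(\<lambda>i. D i k) \<longlonglongrightarrow> 0" for k
      proof -
        have "filterlim (\<lambda>i. X i - real k - 1) (at (t - real k - 1)) sequentially"
          using X by (auto simp: filterlim_at intro!: tendsto_intros)
        moreover have "((\<lambda>s. N (Stepanov_lift g s - Stepanov_lift g (t - real k - 1))) \<longlongrightarrow> 0) (at (t - real k - 1))"
          using g by (simp add: Stepanov_almost_anti_periodic_def almost_anti_periodic_wrt_def N_def)
        ultimately show ?thesis
          unfolding D_def by (rule filterlim_compose[rotated])
      qed
      \<comment> \<open>A finite weight is required here: an infinite one times \<open>D i k\<close>
        need not tend to 0.\<close>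
      moreover have "a k < \<infinity>" for k
        using M unfolding a_def[symmetric] by (metis ennreal_suminf_lessD)
      ultimately have aD: "(\<lambda>i. a k * D i k) \<longlonglongrightarrow> 0" for k
        using ennreal_tendsto_cmult[of "a k" "\<lambda>i. D i k" 0 sequentially] by simp
      \<comment> \<open>The series is read as an integral against counting measure; the dominating
        terms \<open>a k * (C + C)\<close> have a finite sum by assumption \<open>M\<close>.\<close>
      have "(\<lambda>i. \<integral>\<^sup>+ k. a k * D i k \<partial>count_space UNIV) \<longlonglongrightarrow> (\<integral>\<^sup>+ k. 0 \<partial>count_space (UNIV :: nat set))"
      proof (rule nn_integral_dominated_convergence[where w="\<lambda>k. a k * ennreal (C + C)"])
        show "AE k in count_space UNIV. a k * D i k \<le> a k * ennreal (C + C)" for i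
          unfolding D_eq by (intro AE_I2 mult_left_mono D_le) simp
        show "(\<integral>\<^sup>+ k. a k * ennreal (C + C) \<partial>count_space UNIV) < \<infinity>"
          using M by (simp add: nn_integral_count_space_nat a_def ennreal_mult_less_top)
      qed (use aD in auto)
      then have lim: "(\<lambda>i. \<Sum>k. a k * D i k) \<longlonglongrightarrow> 0"
        by (simp add: nn_integral_count_space_nat)
      have "(\<lambda>i. ennreal (norm (G g (X i) - G g t))) \<longlonglongrightarrow> ennreal 0"
        using tendsto_sandwich[OF _ _ tendsto_const lim] bound by auto
      then show "(\<lambda>i. norm (G g (X i) - G g t)) \<longlonglongrightarrow> 0"
        by (subst (asm) tendsto_ennreal_iff) auto
    qed
    then show ?thesis
      by (simp add: isCont_def tendsto_norm_zero_iff LIM_zero_iff)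
  qed

  show ?thesis
    unfolding G_eq almost_anti_periodic_def
    using int dense cont by (auto simp: Bochner_integrable_def continuous_on_eq_continuous_at)
qed

end
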